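(* Let $n\ge1$, let $\mu$ be the volume measure of the round metric on the unit sphere $\mathbb S^n\subset\mathbb R^{n+1}$, let $d(x,y)=\|x-y\|$ be the chordal distance on $\mathbb S^n$, and let $\Delta:\operatorname{Dom}\Delta\to L^2(\mathbb S^n,\mu)$ be the logarithmic Dirichlet Laplacian of the Ahlfors $n$-regular metric-measure space $(\mathbb S^n,d,\mu)$. Let $\gamma\in\mathrm{SO}^+(n+1,1)$, acting on $\mathbb S^n$ by a conformal diffeomorphism, and let $U(\gamma)$ be the unitary operator on $L^2(\mathbb S^n,\mu)$ given by $$U(\gamma)f(x)=|(\gamma^{-1})'(x)|^{n/2}f(\gamma^{-1}x).$$ Then $U(\gamma)$ preserves $\operatorname{Dom}\Delta$ and the commutator $[\Delta,U(\gamma)]:\operatorname{Dom}\Delta\to L^2(\mathbb S^n,\mu)$ extends to a bounded operator.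
   Context: The open unit ball $\mathbb B^{n+1}\subset\mathbb R^{n+1}$ with the Poincaré metric $d\rho=\frac{2\,dx}{1-\|x\|^2}$ is a model of hyperbolic $(n+1)$-space. $\mathrm{SO}^+(n+1,1)$ is identified with its isometry group, and its action extends to an action by conformal diffeomorphisms on the boundary $\mathbb S^n$. For a conformal diffeomorphism $\gamma$ of $\mathbb S^n$, $|\gamma'(x)|$ is the unique positive number such that $\gamma'(x)/|\gamma'(x)|$ is orthogonal, where $\gamma'(x)$ is the derivative of $\gamma$ at $x$ with respect to the round metric. All Hilbert spaces are real. The logarithmic Dirichlet Laplacian of $(\mathbb S^n,d,\mu)$ is defined as follows. Let $$\operatorname{Dom}\mathcal E=\Big\{f\in L^2(\mathbb S^n,\mu):\int_{\mathbb S^n}\int_{\mathbb S^n}\frac{|f(x)-f(y)|^2}{d(x,y)^n}\,d\mu(y)\,d\mu(x)<\infty\Big\},$$ $$\mathcal E(f,g)=\frac12\int_{\mathbb S^n}\int_{\mathbb S^n}\frac{(f(x)-f(y))(g(x)-g(y))}{d(x,y)^n}\,d\mu(y)\,d\mu(x),$$ the integrals being over the complement of the diagonal; this is a densely defined closed form. $\Delta$ is the associated positive self-adjoint operator: if $R:L^2(\mathbb S^n,\mu)\to\operatorname{Dom}\mathcal E$ is determined by $\langle Rf,g\rangle_{L^2}+\mathcal E(Rf,g)=\langle f,g\rangle_{L^2}$ for all $g\in\operatorname{Dom}\mathcal E$, then $\operatorname{Dom}\Delta=\operatorname{Im}R$ and $\Delta Rf=f-Rf$; thus $R=(1+\Delta)^{-1}$,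 $\operatorname{Dom}\mathcal E=\operatorname{Dom}\Delta^{1/2}$ and $\mathcal E(f,g)=\langle\Delta^{1/2}f,\Delta^{1/2}g\rangle_{L^2}$. *)

theory Defs
  imports "HOL-Analysis.Analysis"
begin

subsection \<open>The space of square integrable functions\<close>

text \<open>
  Elements of the real Hilbert space \<open>L\<^sup>2(M)\<close> are represented by square integrable functions;
  two functions represent the same element iff they agree almost everywhere.  Accordingly, operators
  are maps between functions, and identities between elements are stated almost everywhere.
\<close>

definition L2_space :: "'a measure \<Rightarrow> ('a \<Rightarrow> real) set" where
  "L2_space M = {f \<in> borel_measurable M. integrable M (\<lambda>x. (f x)\<^sup>2)}"

definition L2_inner :: "'a measure \<Rightarrow> ('a \<Rightarrow> real) \<Rightarrow> ('a \<Rightarrow> real) \<Rightarrow> real" where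
  "L2_inner M f g = (LINT x|M. f x * g x)"

definition L2_norm :: "'a measure \<Rightarrow> ('a \<Rightarrow> real) \<Rightarrow> real" where
  "L2_norm M f = sqrt (L2_inner M f f)"

text \<open>
  Linearity and the norm bound together force \<open>T\<close> to respect equality almost everywhere, so that it
  descends to a bounded linear operator on the Hilbert space.
\<close>

definition L2_bounded_operator :: "'a measure \<Rightarrow> (('a \<Rightarrow> real) \<Rightarrow> ('a \<Rightarrow> real)) \<Rightarrow> bool" where
  "L2_bounded_operator M T \<longleftrightarrow>
     (\<forall>f\<in>L2_space M. T f \<in> L2_space M) \<and>
     (\<forall>f\<in>L2_space M. \<forall>g\<in>L2_space M. \<forall>a b.
        AE x in M. T (\<lambda>y. a * f y + b * g y) x = a * T f x + b * T g x) \<and>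
     (\<exists>C. \<forall>f\<in>L2_space M. L2_norm M (T f) \<le> C * L2_norm M f)"


subsection \<open>The logarithmic Dirichlet Laplacian\<close>

text \<open>
  The integrals below run over the complement of the diagonal: on the diagonal the numerator
  vanishes, so the integrands are \<open>0\<close> there.
\<close>

definition log_form_dom :: "nat \<Rightarrow> ('a \<Rightarrow> 'a \<Rightarrow> real) \<Rightarrow> 'a measure \<Rightarrow> ('a \<Rightarrow> real) set" where
  "log_form_dom n d M =
     {f \<in> L2_space M. (\<integral>\<^sup>+x. (\<integral>\<^sup>+y. ennreal (\<bar>f x - f y\<bar>\<^sup>2 / d x y ^ n) \<partial>M) \<partial>M) < \<infinity>}"

definition log_form ::
    "nat \<Rightarrow> ('a \<Rightarrow> 'a \<Rightarrow> real) \<Rightarrow> 'a measure \<Rightarrow> ('a \<Rightarrow> real) \<Rightarrow> ('a \<Rightarrow> real) \<Rightarrow> real" where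
  "log_form n d M f g =
     (1 / 2) * (LINT x|M. (LINT y|M. (f x - f y) * (g x - g y) / d x y ^ n))"

text \<open>\<open>u\<close> represents \<open>R f\<close>, where \<open>R\<close> is the resolvent \<open>(1 + \<Delta>)\<^sup>-\<^sup>1\<close>.\<close>

definition is_log_resolvent ::
    "nat \<Rightarrow> ('a \<Rightarrow> 'a \<Rightarrow> real) \<Rightarrow> 'a measure \<Rightarrow> ('a \<Rightarrow> real) \<Rightarrow> ('a \<Rightarrow> real) \<Rightarrow> bool" where
  "is_log_resolvent n d M f u \<longleftrightarrow>
     f \<in> L2_space M \<and> u \<in> log_form_dom n d M \<and>
     (\<forall>g\<in>log_form_dom n d M. L2_inner M u g + log_form n d M u g = L2_inner M f g)"

definition log_laplacian_dom ::
    "nat \<Rightarrow> ('a \<Rightarrow> 'a \<Rightarrow> real) \<Rightarrow> 'a measure \<Rightarrow> ('a \<Rightarrow> real) set" where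
  "log_laplacian_dom n d M = {u. \<exists>f. is_log_resolvent n d M f u}"

text \<open>
  \<open>\<Delta> (R f) = f - R f\<close>.  The function \<open>f\<close> is determined by \<open>u = R f\<close> only up to almost everywhere
  equality (as the form is densely defined); the choice operator selects one representative.
\<close>

definition log_laplacian ::
    "nat \<Rightarrow> ('a \<Rightarrow> 'a \<Rightarrow> real) \<Rightarrow> 'a measure \<Rightarrow> ('a \<Rightarrow> real) \<Rightarrow> ('a \<Rightarrow> real)" where
  "log_laplacian n d M u = (\<lambda>x. (SOME f. is_log_resolvent n d M f u) x - u x)"


subsection \<open>The round unit sphere\<close>

text \<open>
  The Riemannian volume of the unit sphere of an \<open>N\<close>-dimensional Euclidean space, normalised by
  polar coordinates \<open>dx = r\<^bsup>N-1\<^esup> dr d\<mu>\<close>: the volume of a Borel set \<open>B\<close> in the sphere is \<open>N\<close> times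
  the Lebesgue measure of the cone of all \<open>r x\<close> with \<open>0 < r < 1\<close> and \<open>x\<close> in \<open>B\<close>.
  Note that \<open>sgn x = x / \<parallel>x\<parallel>\<close> is the radial projection.
\<close>

definition sphere_measure :: "'a::euclidean_space measure" where
  "sphere_measure = scale_measure (of_nat DIM('a))
     (distr (restrict_space lborel (ball 0 1 - {0})) (restrict_space borel (sphere 0 1)) sgn)"

text \<open>
  The number \<open>\<bar>g'(x)\<bar>\<close> for a conformal self-map \<open>g\<close> of the unit sphere.  The tangent space at \<open>x\<close>
  is the orthogonal complement of \<open>x\<close>, with the inner product of the ambient space.  A derivative
  within the sphere is determined only on that tangent space, and only there is it used.
\<close>

definition conformal_factor :: "('a::euclidean_space \<Rightarrow> 'a) \<Rightarrow> 'a \<Rightarrow> real" where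
  "conformal_factor g x =
     (THE c. c > 0 \<and>
        (\<exists>D. (g has_derivative D) (at x within sphere 0 1) \<and>
             (\<forall>v w. v \<bullet> x = 0 \<longrightarrow> w \<bullet> x = 0 \<longrightarrow> (D v /\<^sub>R c) \<bullet> (D w /\<^sub>R c) = v \<bullet> w)))"


subsection \<open>The Lorentz group and its action\<close>

text \<open>
  Minkowski space is indexed by \<open>'m option\<close>: the coordinates \<open>Some i\<close> are the spatial ones and
  \<open>None\<close> is the time coordinate.
\<close>

definition lorentz_form :: "real ^ ('m::finite option) \<Rightarrow> real ^ ('m option) \<Rightarrow> real" where
  "lorentz_form v w = (\<Sum>i\<in>UNIV. v $ Some i * w $ Some i) - v $ None * w $ None"

definition SO_plus :: "(real ^ ('m::finite option) ^ ('m option)) set" where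
  "SO_plus = {A. (\<forall>v w. lorentz_form (A *v v) (A *v w) = lorentz_form v w) \<and>
                 det A = 1 \<and> A $ None $ None > 0}"

text \<open>
  The action on the closed unit ball.  The Poincare ball is identified with the hyperboloid by
  \<open>x \<mapsto> (2 x, 1 + \<parallel>x\<parallel>\<^sup>2) / (1 - \<parallel>x\<parallel>\<^sup>2)\<close>, with inverse \<open>(y, t) \<mapsto> y / (1 + t)\<close>.  Clearing the
  denominator \<open>1 - \<parallel>x\<parallel>\<^sup>2\<close> gives a formula that also makes sense on the boundary, where it is the
  continuous extension of the action on the ball and amounts to the action on light rays.
\<close>

definition ball_lift :: "real ^ 'm \<Rightarrow> real ^ ('m::finite option)" where
  "ball_lift x = (\<chi> j. case j of None \<Rightarrow> 1 + (norm x)\<^sup>2 | Some i \<Rightarrow> 2 * x $ i)"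

definition lorentz_action :: "real ^ ('m::finite option) ^ ('m option) \<Rightarrow> real ^ 'm \<Rightarrow> real ^ 'm" where
  "lorentz_action A x =
     (let v = A *v ball_lift x in (\<chi> i. v $ Some i) /\<^sub>R (v $ None + (1 - (norm x)\<^sup>2)))"

definition lorentz_unitary ::
    "nat \<Rightarrow> real ^ ('m::finite option) ^ ('m option) \<Rightarrow> (real ^ 'm \<Rightarrow> real) \<Rightarrow> (real ^ 'm \<Rightarrow> real)" where
  "lorentz_unitary n A f =
     (let h = lorentz_action (matrix_inv A)
      in (\<lambda>x. conformal_factor h x powr (real n / 2) * f (h x)))"

end

theory Submission
  imports Defs
begin

text \<open>
  Write \<open>h\<close> for the action of \<open>\<gamma>\<^sup>-\<^sup>1\<close> on the sphere, \<open>k\<close> for its inverse, and let \<open>a = \<bar>h'\<bar>\<^bsup>n/2\<^esup>\<close>, so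
  that \<open>U f = a \<cdot> (f \<circ> h)\<close>.  Two facts about a conformal map of the sphere are used: the
  chordal distance satisfies \<open>d(h x, h y)\<^sup>n = a(x) a(y) d(x, y)\<^sup>n\<close>, and the Jacobian of \<open>h\<close> is \<open>a\<^sup>2\<close>.
  Inserting them into the form and substituting \<open>h\<close> in both variables gives, with \<open>q = a \<circ> k\<close>,

  \<open>\<E>(U f, U g) = 1/2 \<integral>\<integral> (q(x) f(x) - q(y) f(y)) (q(x) g(x) - q(y) g(y)) / (q(x) q(y) d(x, y)\<^sup>n)\<close>.

  Expanding the product, the integrand is that of \<open>\<E>(f, g)\<close> plus
  \<open>(q(x)/q(y) - 1) f(x) g(x) / d(x, y)\<^sup>n\<close> and the same term with \<open>x\<close> and \<open>y\<close> exchanged.  Since \<open>q\<close> is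
  Lipschitz and bounded away from \<open>0\<close>, the factor \<open>q(x)/q(y) - 1\<close> is \<open>O(d(x, y))\<close>, and
  \<open>d(x, y)\<^bsup>1-n\<^esup>\<close> is integrable over an \<open>n\<close>-dimensional sphere, uniformly in \<open>x\<close>.  Hence
  \<open>\<E>(U f, U g) = \<E>(f, g) + \<langle>V f, g\<rangle>\<close> with the bounded function
  \<open>V(x) = \<integral> (q(x)/q(y) - 1) / d(x, y)\<^sup>n dy\<close> (\<open>U_form\<close>).  In terms of operators, \<open>U\<close> preserves the
  domain of \<open>\<Delta>\<close> and \<open>[\<Delta>, U] = U V\<close>, which is bounded.

  This reasoning is carried out in the locale \<open>conformal_transport\<close> and ends with
  \<open>bounded_commutator\<close>.  The rest verifies the hypotheses for the sphere.  The action is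
  extended to the ambient space by lifting \<open>x\<close> to the light-like vector \<open>(x, \<parallel>x\<parallel>)\<close>, applying the
  Lorentz matrix and rescaling so that the norm is preserved.  The derivative of this extension
  has the Gram matrix of a map that is isometric in the radial direction and conformal
  orthogonally to it (\<open>cone_map_derivative_gram\<close>); that yields both the conformal factor and, through the
  change of variables formula on cones, the Jacobian (\<open>distr_cone_map_sphere_measure\<close>).  The
  kernel estimate is \<open>sphere_kernel_bound\<close>, and the form domain is dense because it contains the
  Lipschitz functions (\<open>log_form_dom_sphere_separates\<close>).
\<close>

section \<open>Square integrable functions and the logarithmic form\<close>

lemma L2_space_measurable: "f \<in> L2_space M \<Longrightarrow> f \<in> borel_measurable M"
  by (simp add: L2_space_def)

lemma L2_space_integrable_mult:
  assumes "f \<in> L2_space M" "g \<in> L2_space M"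
  shows "integrable M (\<lambda>x. f x * g x)"
proof (rule Bochner_Integration.integrable_bound)
  show "integrable M (\<lambda>x. (f x)\<^sup>2 + (g x)\<^sup>2)"
    using assms by (auto simp: L2_space_def)
  show "(\<lambda>x. f x * g x) \<in> borel_measurable M"
    using assms by (auto simp: L2_space_def)
  have "\<bar>u * v\<bar> \<le> u\<^sup>2 + v\<^sup>2" for u v :: real
    using sum_squares_bound[of "\<bar>u\<bar>" "\<bar>v\<bar>"] abs_ge_zero[of "u * v"] unfolding abs_mult power2_abs by linarith
  then show "AE x in M. norm (f x * g x) \<le> norm ((f x)\<^sup>2 + (g x)\<^sup>2)"
    by auto
qed

lemma L2_space_bounded_mult:
  assumes f: "f \<in> L2_space M" and v: "v \<in> borel_measurable M"
    and bound: "\<And>x. x \<in> space M \<Longrightarrow> \<bar>v x\<bar> \<le> C"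
  shows "(\<lambda>x. v x * f x) \<in> L2_space M"
    and "L2_norm M (\<lambda>x. v x * f x) \<le> C * L2_norm M f"
proof -
  have le: "(v x * f x)\<^sup>2 \<le> C\<^sup>2 * (f x)\<^sup>2" if "x \<in> space M" for x
    using power_mono[OF bound[OF that], of 2] by (auto simp: power_mult_distrib intro: mult_right_mono)
  have int: "integrable M (\<lambda>x. C\<^sup>2 * (f x)\<^sup>2)"
    using f by (auto simp: L2_space_def)
  have [measurable]: "f \<in> borel_measurable M" "v \<in> borel_measurable M"
    using f v by (auto simp: L2_space_def)
  have int': "integrable M (\<lambda>x. (v x * f x)\<^sup>2)"
    by (rule Bochner_Integration.integrable_bound[OF int]) (auto intro!: AE_I2 simp: le)
  then show "(\<lambda>x. v x * f x) \<in> L2_space M"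
    by (auto simp: L2_space_def)
  show "L2_norm M (\<lambda>x. v x * f x) \<le> C * L2_norm M f"
  proof (cases "space M = {}")
    case True
    then show ?thesis
      by (simp add: L2_norm_def L2_inner_def Bochner_Integration.integral_empty)
  next
    case False
    then have "C \<ge> 0" using bound by fastforce
    have "(LINT x|M. (v x * f x)\<^sup>2) \<le> (LINT x|M. C\<^sup>2 * (f x)\<^sup>2)"
      using int' int by (rule integral_mono) (rule le)
    then have "sqrt (LINT x|M. (v x * f x)\<^sup>2) \<le> sqrt (C\<^sup>2 * (LINT x|M. (f x)\<^sup>2))"
      by simp
    then show ?thesis
      using \<open>C \<ge> 0\<close> by (simp add: L2_norm_def L2_inner_def real_sqrt_mult flip: power2_eq_square)
  qed
qed

lemma L2_space_add:
  assumes "f \<in> L2_space M" "g \<in> L2_space M"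
  shows "(\<lambda>x. f x + g x) \<in> L2_space M"
  using assms L2_space_integrable_mult[OF assms]
  by (auto simp: L2_space_def power2_sum mult.assoc)

lemma L2_space_diff:
  assumes "f \<in> L2_space M" "g \<in> L2_space M"
  shows "(\<lambda>x. f x - g x) \<in> L2_space M"
  using assms L2_space_integrable_mult[OF assms]
  by (auto simp: L2_space_def power2_diff mult.assoc)

lemma L2_space_cong:
  assumes "f \<in> L2_space M" "\<And>x. x \<in> space M \<Longrightarrow> f x = g x"
  shows "g \<in> L2_space M"
  using assms measurable_cong[of M f g borel]
    Bochner_Integration.integrable_cong[OF refl, of M "\<lambda>x. (f x)\<^sup>2" "\<lambda>x. (g x)\<^sup>2"]
  by (auto simp: L2_space_def)

lemma log_form_dom_cong:
  assumes "f \<in> log_form_dom n d M" "\<And>x. x \<in> space M \<Longrightarrow> f x = g x"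
  shows "g \<in> log_form_dom n d M"
proof -
  have "(\<integral>\<^sup>+x. (\<integral>\<^sup>+y. ennreal (\<bar>f x - f y\<bar>\<^sup>2 / d x y ^ n) \<partial>M) \<partial>M) =
        (\<integral>\<^sup>+x. (\<integral>\<^sup>+y. ennreal (\<bar>g x - g y\<bar>\<^sup>2 / d x y ^ n) \<partial>M) \<partial>M)"
    using assms(2) by (auto intro!: nn_integral_cong)
  then show ?thesis
    using assms L2_space_cong[of f M g] by (auto simp: log_form_dom_def)
qed

lemma L2_inner_cong:
  assumes "\<And>x. x \<in> space M \<Longrightarrow> f x = f' x" "\<And>x. x \<in> space M \<Longrightarrow> g x = g' x"
  shows "L2_inner M f g = L2_inner M f' g'"
  unfolding L2_inner_def using assms by (auto intro!: Bochner_Integration.integral_cong)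

lemma log_form_cong:
  assumes "\<And>x. x \<in> space M \<Longrightarrow> f x = f' x" "\<And>x. x \<in> space M \<Longrightarrow> g x = g' x"
  shows "log_form n d M f g = log_form n d M f' g'"
  unfolding log_form_def using assms by (auto intro!: Bochner_Integration.integral_cong)

lemma is_log_resolvent_cong:
  assumes "is_log_resolvent n d M f u" "\<And>x. x \<in> space M \<Longrightarrow> u x = v x"
  shows "is_log_resolvent n d M f v"
  using assms log_form_dom_cong[of u n d M v] L2_inner_cong[of M u v] log_form_cong[of M u v]
  unfolding is_log_resolvent_def by auto

section \<open>Weighted composition operators of conformal transformations\<close>

text \<open>
  The setting of the argument, stripped of all geometry.  The weight \<open>a\<close> is \<open>\<bar>h'\<bar>\<^bsup>n/2\<^esup>\<close>, so
  \<open>conformal\<close> is the \<open>n\<close>-th power of the two-point identity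
  \<open>d (h x) (h y) = \<bar>h' x\<bar>\<^bsup>1/2\<^esup> \<bar>h' y\<bar>\<^bsup>1/2\<^esup> d x y\<close>, and \<open>transport\<close> says that \<open>h\<close> has Jacobian
  \<open>\<bar>h'\<bar>\<^sup>n\<close>.  The two ratio bounds express that the weights of \<open>h\<close> and of its inverse \<open>k\<close> are
  regular enough to compensate the kernel \<open>1 / d\<^sup>n\<close>, which by itself is not integrable; both are
  included so that the assumptions are inherited by the inverse.
\<close>
locale conformal_transport = finite_measure M
  for M :: "'a measure" +
  fixes n :: nat and d :: "'a \<Rightarrow> 'a \<Rightarrow> real" and h k :: "'a \<Rightarrow> 'a" and a :: "'a \<Rightarrow> real" and C :: real
  assumes d_measurable[measurable]: "(\<lambda>(x, y). d x y) \<in> borel_measurable (M \<Otimes>\<^sub>M M)"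
    and d_nonneg: "\<And>x y. 0 \<le> d x y"
    and d_sym: "\<And>x y. d x y = d y x"
    and h_measurable[measurable]: "h \<in> M \<rightarrow>\<^sub>M M"
    and k_measurable[measurable]: "k \<in> M \<rightarrow>\<^sub>M M"
    and hk: "\<And>x. x \<in> space M \<Longrightarrow> h (k x) = x"
    and kh: "\<And>x. x \<in> space M \<Longrightarrow> k (h x) = x"
    and a_measurable[measurable]: "a \<in> borel_measurable M"
    and a_pos: "\<And>x. x \<in> space M \<Longrightarrow> 0 < a x"
    and conformal: "\<And>x y. x \<in> space M \<Longrightarrow> y \<in> space M \<Longrightarrow>
          d (h x) (h y) ^ n = a x * a y * d x y ^ n"
    and transport: "distr (density M (\<lambda>x. ennreal ((a x)\<^sup>2))) M h = M"
    and ratio_bound: "\<And>x. x \<in> space M \<Longrightarrow>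
          (\<integral>\<^sup>+y. ennreal (\<bar>a (k x) / a (k y) - 1\<bar> / d x y ^ n) \<partial>M) \<le> ennreal C"
    and ratio_bound': "\<And>x. x \<in> space M \<Longrightarrow>
          (\<integral>\<^sup>+y. ennreal (\<bar>a y / a x - 1\<bar> / d x y ^ n) \<partial>M) \<le> ennreal C"
begin

sublocale MM: pair_sigma_finite M M ..

lemma h_space: "x \<in> space M \<Longrightarrow> h x \<in> space M"
  and k_space: "x \<in> space M \<Longrightarrow> k x \<in> space M"
  by (rule measurable_space[OF h_measurable], assumption) (rule measurable_space[OF k_measurable])

lemma nn_integral_transport:
  assumes [measurable]: "\<phi> \<in> borel_measurable M"
  shows "(\<integral>\<^sup>+x. ennreal ((a x)\<^sup>2) * \<phi> (h x) \<partial>M) = (\<integral>\<^sup>+x. \<phi> x \<partial>M)"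
proof -
  have "(\<integral>\<^sup>+x. \<phi> x \<partial>M) = (\<integral>\<^sup>+x. \<phi> x \<partial>distr (density M (\<lambda>x. ennreal ((a x)\<^sup>2))) M h)"
    by (simp add: transport)
  then show ?thesis
    by (simp add: nn_integral_distr nn_integral_density)
qed

lemma integral_transport:
  fixes \<phi> :: "'a \<Rightarrow> real"
  assumes [measurable]: "\<phi> \<in> borel_measurable M"
  shows "(LINT x|M. (a x)\<^sup>2 * \<phi> (h x)) = (LINT x|M. \<phi> x)"
    and "integrable M (\<lambda>x. (a x)\<^sup>2 * \<phi> (h x)) \<longleftrightarrow> integrable M \<phi>"
proof -
  have "(LINT x|M. \<phi> x) = (LINT x|distr (density M (\<lambda>x. ennreal ((a x)\<^sup>2))) M h. \<phi> x)"
    by (simp add: transport)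
  then show "(LINT x|M. (a x)\<^sup>2 * \<phi> (h x)) = (LINT x|M. \<phi> x)"
    by (simp add: integral_distr integral_real_density)
  have "integrable M \<phi> \<longleftrightarrow> integrable (distr (density M (\<lambda>x. ennreal ((a x)\<^sup>2))) M h) \<phi>"
    by (simp add: transport)
  then show "integrable M (\<lambda>x. (a x)\<^sup>2 * \<phi> (h x)) \<longleftrightarrow> integrable M \<phi>"
    by (simp add: integrable_distr_eq integrable_real_density)
qed

definition U :: "('a \<Rightarrow> real) \<Rightarrow> 'a \<Rightarrow> real" where
  "U f = (\<lambda>x. a x * f (h x))"

lemma U_L2:
  assumes "f \<in> L2_space M"
  shows "U f \<in> L2_space M"
proof -
  have [measurable]: "f \<in> borel_measurable M" using assms by (rule L2_space_measurable)
  have "U f \<in> borel_measurable M" unfolding U_def by measurable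
  moreover have "integrable M (\<lambda>x. (a x)\<^sup>2 * (f (h x))\<^sup>2)"
    using integral_transport(2)[of "\<lambda>x. (f x)\<^sup>2"] assms by (simp add: L2_space_def)
  ultimately show ?thesis
    by (simp add: L2_space_def U_def power_mult_distrib)
qed

lemma U_inner:
  assumes "f \<in> L2_space M" "g \<in> L2_space M"
  shows "L2_inner M (U f) (U g) = L2_inner M f g"
proof -
  have [measurable]: "f \<in> borel_measurable M" "g \<in> borel_measurable M"
    using assms by (auto intro: L2_space_measurable)
  show ?thesis
    using integral_transport(1)[of "\<lambda>x. f x * g x"]
    by (simp add: L2_inner_def U_def power2_eq_square mult_ac)
qed

text \<open>
  The weight of the inverse \<open>k\<close> is \<open>1 / a \<circ> k\<close>; passing to the inverse interchanges the two ratio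
  bounds.
\<close>
lemma inverse_transport: "conformal_transport M n d k h (\<lambda>x. 1 / a (k x)) C"
proof (unfold_locales)
  let ?b = "\<lambda>x. 1 / a (k x)"
  show "?b \<in> borel_measurable M" by measurable
  show "0 < ?b x" if "x \<in> space M" for x using that by (simp add: a_pos k_space)
  show "d (k x) (k y) ^ n = ?b x * ?b y * d x y ^ n" if "x \<in> space M" "y \<in> space M" for x y
    using conformal[of "k x" "k y"] that a_pos[of "k x"] a_pos[of "k y"]
    by (simp add: hk k_space field_simps)
  show "distr (density M (\<lambda>x. ennreal ((?b x)\<^sup>2))) M k = M"
  proof (rule measure_eqI)
    fix B assume "B \<in> sets (distr (density M (\<lambda>x. ennreal ((?b x)\<^sup>2))) M k)"
    then have [measurable]: "B \<in> sets M" by simp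
    have "emeasure (distr (density M (\<lambda>x. ennreal ((?b x)\<^sup>2))) M k) B =
          (\<integral>\<^sup>+x. indicator B x \<partial>distr (density M (\<lambda>x. ennreal ((?b x)\<^sup>2))) M k)"
      by simp
    also have "\<dots> = (\<integral>\<^sup>+x. ennreal ((?b x)\<^sup>2) * indicator B (k x) \<partial>M)"
      by (simp add: nn_integral_distr nn_integral_density del: nn_integral_indicator)
    also have "\<dots> = (\<integral>\<^sup>+x. ennreal ((a x)\<^sup>2) * (ennreal ((?b (h x))\<^sup>2) * indicator B (k (h x))) \<partial>M)"
      by (rule nn_integral_transport[symmetric]) measurable
    also have "\<dots> = (\<integral>\<^sup>+x. indicator B x \<partial>M)"
      using a_pos by (intro nn_integral_cong) (auto simp: kh power_divide indicator_def less_imp_neq[THEN not_sym] simp flip: ennreal_mult)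
    finally show "emeasure (distr (density M (\<lambda>x. ennreal ((?b x)\<^sup>2))) M k) B = emeasure M B"
      by simp
  qed simp
  fix x assume x: "x \<in> space M"
  show "(\<integral>\<^sup>+y. ennreal (\<bar>?b (h x) / ?b (h y) - 1\<bar> / d x y ^ n) \<partial>M) \<le> ennreal C"
    using ratio_bound'[OF x] x by (simp add: kh cong: nn_integral_cong_simp)
  show "(\<integral>\<^sup>+y. ennreal (\<bar>?b y / ?b x - 1\<bar> / d x y ^ n) \<partial>M) \<le> ennreal C"
    using ratio_bound[OF x] x by simp
qed (auto simp: hk kh d_nonneg d_sym)

text \<open>
  The weight expressed at the image point: \<open>target_weight (h x) = a x\<close>.
\<close>
definition target_weight :: "'a \<Rightarrow> real" where "target_weight x = a (k x)"

lemma target_weight_measurable[measurable]: "target_weight \<in> borel_measurable M"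
  unfolding target_weight_def by measurable

lemma target_weight_pos: "x \<in> space M \<Longrightarrow> 0 < target_weight x"
  unfolding target_weight_def by (simp add: a_pos k_space)

text \<open>
  The multiplication operator by this function is the defect of invariance of the form under the
  unitary; see \<open>U_form\<close>.
\<close>
definition potential :: "'a \<Rightarrow> real" where
  "potential x = (LINT y|M. (target_weight x / target_weight y - 1) / d x y ^ n)"

lemma potential_measurable[measurable]: "potential \<in> borel_measurable M"
  unfolding potential_def by measurable

lemma potential_bound:
  assumes x: "x \<in> space M"
  shows "\<bar>potential x\<bar> \<le> max C 0"
proof -
  have "ennreal (norm (LINT y|M. (target_weight x / target_weight y - 1) / d x y ^ n)) \<le>
        (\<integral>\<^sup>+y. ennreal (norm ((target_weight x / target_weight y - 1) / d x y ^ n)) \<partial>M)"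
  proof (cases "integrable M (\<lambda>y. (target_weight x / target_weight y - 1) / d x y ^ n)")
    case True
    then show ?thesis by (rule integral_norm_bound_ennreal)
  qed (simp add: not_integrable_integral_eq)
  also have "\<dots> \<le> ennreal C"
    using ratio_bound[OF x] by (simp add: target_weight_def d_nonneg)
  finally show ?thesis
    unfolding potential_def by (auto simp: ennreal_le_iff2)
qed

definition ratio_density :: "('a \<Rightarrow> real) \<Rightarrow> 'a \<times> 'a \<Rightarrow> real" where
  "ratio_density \<psi> = (\<lambda>(x, y). (target_weight x / target_weight y - 1) / d x y ^ n * \<psi> x)"

text \<open>
  The ratio bound gives absolute convergence, so the two correction terms can be separated from the
  energy density and each be integrated one variable at a time.
\<close>
lemma ratio_density_integrable:
  assumes \<psi>: "integrable M \<psi>"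
  shows "integrable (M \<Otimes>\<^sub>M M) (ratio_density \<psi>)"
proof (rule integrableI_bounded)
  have [measurable]: "\<psi> \<in> borel_measurable M" using \<psi> by simp
  show [measurable]: "ratio_density \<psi> \<in> borel_measurable (M \<Otimes>\<^sub>M M)"
    unfolding ratio_density_def by measurable
  have "(\<integral>\<^sup>+z. ennreal (norm (ratio_density \<psi> z)) \<partial>(M \<Otimes>\<^sub>M M)) =
        (\<integral>\<^sup>+x. (\<integral>\<^sup>+y. ennreal (norm (ratio_density \<psi> (x, y))) \<partial>M) \<partial>M)"
    by (rule nn_integral_fst[symmetric]) measurable
  also have "\<dots> = (\<integral>\<^sup>+x. (\<integral>\<^sup>+y. ennreal (\<bar>a (k x) / a (k y) - 1\<bar> / d x y ^ n) * ennreal \<bar>\<psi> x\<bar> \<partial>M) \<partial>M)"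
    by (simp add: ratio_density_def target_weight_def abs_mult d_nonneg flip: ennreal_mult)
  also have "\<dots> = (\<integral>\<^sup>+x. (\<integral>\<^sup>+y. ennreal (\<bar>a (k x) / a (k y) - 1\<bar> / d x y ^ n) \<partial>M) * ennreal \<bar>\<psi> x\<bar> \<partial>M)"
    by (intro nn_integral_cong nn_integral_multc) measurable
  also have "\<dots> \<le> (\<integral>\<^sup>+x. ennreal C * ennreal \<bar>\<psi> x\<bar> \<partial>M)"
    by (intro nn_integral_mono mult_right_mono ratio_bound) auto
  also have "\<dots> = ennreal C * (\<integral>\<^sup>+x. ennreal (norm (\<psi> x)) \<partial>M)"
    by (simp add: nn_integral_cmult)
  also have "\<dots> < \<infinity>"
    using \<psi> by (simp add: integrable_iff_bounded ennreal_mult_less_top)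
  finally show "(\<integral>\<^sup>+z. ennreal (norm (ratio_density \<psi> z)) \<partial>(M \<Otimes>\<^sub>M M)) < \<infinity>" .
qed

lemma ratio_density_integral:
  assumes \<psi>: "integrable M \<psi>"
  shows "(LINT z|(M \<Otimes>\<^sub>M M). ratio_density \<psi> z) = (LINT x|M. potential x * \<psi> x)"
proof -
  have "(LINT z|(M \<Otimes>\<^sub>M M). ratio_density \<psi> z) = (LINT x|M. (LINT y|M. ratio_density \<psi> (x, y)))"
    by (rule MM.integral_fst'[symmetric, OF ratio_density_integrable[OF \<psi>]])
  also have "\<dots> = (LINT x|M. potential x * \<psi> x)"
    by (simp only: ratio_density_def potential_def prod.case integral_mult_left_zero)
  finally show ?thesis .
qed

definition energy_density :: "('a \<Rightarrow> real) \<Rightarrow> ('a \<Rightarrow> real) \<Rightarrow> 'a \<times> 'a \<Rightarrow> real" where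
  "energy_density f g = (\<lambda>(x, y). (f x - f y) * (g x - g y) / d x y ^ n)"

lemma log_form_dom_L2: "f \<in> log_form_dom n d M \<Longrightarrow> f \<in> L2_space M"
  by (simp add: log_form_dom_def)

lemma log_form_dom_iff:
  "f \<in> log_form_dom n d M \<longleftrightarrow> f \<in> L2_space M \<and> integrable (M \<Otimes>\<^sub>M M) (energy_density f f)"
proof (cases "f \<in> L2_space M")
  case True
  then have [measurable]: "f \<in> borel_measurable M" by (rule L2_space_measurable)
  have [measurable]: "energy_density f f \<in> borel_measurable (M \<Otimes>\<^sub>M M)"
    unfolding energy_density_def by measurable
  have "(\<integral>\<^sup>+x. (\<integral>\<^sup>+y. ennreal (\<bar>f x - f y\<bar>\<^sup>2 / d x y ^ n) \<partial>M) \<partial>M) =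
        (\<integral>\<^sup>+x. (\<integral>\<^sup>+y. ennreal (norm (energy_density f f (x, y))) \<partial>M) \<partial>M)"
    by (simp add: energy_density_def d_nonneg power2_eq_square abs_mult)
  also have "\<dots> = (\<integral>\<^sup>+z. ennreal (norm (energy_density f f z)) \<partial>(M \<Otimes>\<^sub>M M))"
    by (rule nn_integral_fst) measurable
  finally show ?thesis
    using True by (simp add: log_form_dom_def integrable_iff_bounded)
qed (simp add: log_form_dom_def)

text \<open>
  Polarisation: \<open>\<bar>s t\<bar> \<le> s\<^sup>2 + t\<^sup>2\<close> applied to the two increments.
\<close>
lemma energy_density_integrable:
  assumes "f \<in> log_form_dom n d M" "g \<in> log_form_dom n d M"
  shows "integrable (M \<Otimes>\<^sub>M M) (energy_density f g)"
proof (rule Bochner_Integration.integrable_bound)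
  show "integrable (M \<Otimes>\<^sub>M M) (\<lambda>z. energy_density f f z + energy_density g g z)"
    using assms by (auto simp: log_form_dom_iff)
  have [measurable]: "f \<in> borel_measurable M" "g \<in> borel_measurable M"
    using assms by (auto intro: L2_space_measurable log_form_dom_L2)
  show "energy_density f g \<in> borel_measurable (M \<Otimes>\<^sub>M M)"
    unfolding energy_density_def by measurable
  have *: "\<bar>u * v\<bar> \<le> u * u + v * v" for u v :: real
    using sum_squares_bound[of "\<bar>u\<bar>" "\<bar>v\<bar>"] abs_ge_zero[of "u * v"]
    unfolding abs_mult power2_abs power2_eq_square by linarith
  have "\<bar>u * v / w\<bar> \<le> \<bar>u * u / w + v * v / w\<bar>" if "w \<ge> 0" for u v w :: real
    using divide_right_mono[OF *[of u v] that] that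
    by (simp add: abs_mult add_divide_distrib)
  then show "AE z in M \<Otimes>\<^sub>M M. norm (energy_density f g z) \<le> norm (energy_density f f z + energy_density g g z)"
    by (auto simp: energy_density_def d_nonneg)
qed

lemma log_form_eq_energy_density:
  assumes "f \<in> log_form_dom n d M" "g \<in> log_form_dom n d M"
  shows "log_form n d M f g = 1 / 2 * (LINT z|(M \<Otimes>\<^sub>M M). energy_density f g z)"
  using MM.integral_fst'[OF energy_density_integrable[OF assms]]
  by (simp add: log_form_def energy_density_def)

text \<open>
  The energy density of \<open>U f\<close> and \<open>U g\<close> as a function of the image points \<open>h x\<close> and \<open>h y\<close>, divided
  by the Jacobians \<open>(a x)\<^sup>2\<close> and \<open>(a y)\<^sup>2\<close> of the substitution.
\<close>
definition transported_density :: "('a \<Rightarrow> real) \<Rightarrow> ('a \<Rightarrow> real) \<Rightarrow> 'a \<times> 'a \<Rightarrow> real" where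
  "transported_density f g = (\<lambda>(x, y).
     (target_weight x * f x - target_weight y * f y) * (target_weight x * g x - target_weight y * g y)
     / (target_weight x * target_weight y * d x y ^ n))"

lemma transported_density_measurable:
  assumes [measurable]: "f \<in> borel_measurable M" "g \<in> borel_measurable M"
  shows "transported_density f g \<in> borel_measurable (M \<Otimes>\<^sub>M M)"
  unfolding transported_density_def by measurable

text \<open>
  With \<open>p\<close> and \<open>q\<close> the weights at the two points, the identity
  \<open>(p f - q f') (p g - q g') / (p q) = (f - f') (g - g') + (p/q - 1) f g + (q/p - 1) f' g'\<close>
  isolates the original energy density; the rest only involves products at a single point.
\<close>
lemma transported_density_eq:
  assumes "x \<in> space M" "y \<in> space M"
  shows "transported_density f g (x, y) = energy_density f g (x, y) + ratio_density (\<lambda>x. f x * g x) (x, y) + ratio_density (\<lambda>x. f x * g x) (y, x)"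
proof -
  let ?p = "target_weight x" and ?q = "target_weight y"
  have "?p > 0" "?q > 0" using assms by (auto simp: target_weight_pos)
  then have "(?p * f x - ?q * f y) * (?p * g x - ?q * g y) / (?p * ?q) =
     (f x - f y) * (g x - g y) + (?p / ?q - 1) * (f x * g x) + (?q / ?p - 1) * (f y * g y)"
    by (simp add: field_simps)
  then have "(?p * f x - ?q * f y) * (?p * g x - ?q * g y) / (?p * ?q) / d x y ^ n =
     ((f x - f y) * (g x - g y) + (?p / ?q - 1) * (f x * g x) + (?q / ?p - 1) * (f y * g y)) / d x y ^ n"
    by simp
  then show ?thesis
    by (simp add: transported_density_def energy_density_def ratio_density_def d_sym[of y x] add_divide_distrib)
qed

lemma transported_density_integral:
  assumes f: "f \<in> log_form_dom n d M" and g: "g \<in> log_form_dom n d M"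
  shows "integrable (M \<Otimes>\<^sub>M M) (transported_density f g)"
    and "1 / 2 * (LINT z|(M \<Otimes>\<^sub>M M). transported_density f g z) = log_form n d M f g + (LINT x|M. potential x * (f x * g x))"
proof -
  let ?R = "ratio_density (\<lambda>x. f x * g x)"
  have fg: "integrable M (\<lambda>x. f x * g x)"
    using f g by (auto intro: L2_space_integrable_mult log_form_dom_L2)
  note ratio_int = ratio_density_integrable[OF fg] and energy_int = energy_density_integrable[OF f g]
  have swap_int: "integrable (M \<Otimes>\<^sub>M M) (\<lambda>(x, y). ?R (y, x))"
    by (rule MM.integrable_product_swap[OF ratio_int])
  have *: "transported_density f g z = energy_density f g z + ?R z + (case z of (x, y) \<Rightarrow> ?R (y, x))" if "z \<in> space (M \<Otimes>\<^sub>M M)" for z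
    using that by (auto simp: space_pair_measure transported_density_eq split: prod.splits)
  show "integrable (M \<Otimes>\<^sub>M M) (transported_density f g)"
    using ratio_int energy_int swap_int by (subst Bochner_Integration.integrable_cong[OF refl *]) auto
  have "(LINT z|(M \<Otimes>\<^sub>M M). transported_density f g z) = (LINT z|(M \<Otimes>\<^sub>M M). energy_density f g z + ?R z + (case z of (x, y) \<Rightarrow> ?R (y, x)))"
    by (rule Bochner_Integration.integral_cong[OF refl *])
  also have "\<dots> = (LINT z|(M \<Otimes>\<^sub>M M). energy_density f g z) + (LINT z|(M \<Otimes>\<^sub>M M). ?R z) +
       (LINT z|(M \<Otimes>\<^sub>M M). (case z of (x, y) \<Rightarrow> ?R (y, x)))"
    using ratio_int energy_int swap_int by simp
  also have "(LINT z|(M \<Otimes>\<^sub>M M). (case z of (x, y) \<Rightarrow> ?R (y, x))) = (LINT z|(M \<Otimes>\<^sub>M M). ?R z)"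
    using ratio_int by (intro MM.integral_product_swap) auto
  finally show "1 / 2 * (LINT z|(M \<Otimes>\<^sub>M M). transported_density f g z) = log_form n d M f g + (LINT x|M. potential x * (f x * g x))"
    by (simp add: log_form_eq_energy_density[OF f g] ratio_density_integral[OF fg])
qed

text \<open>
  One factor \<open>a x * a y\<close> comes from the kernel through \<open>conformal\<close>; the other cancels the
  denominator of the transported density.
\<close>
lemma U_energy_density_eq:
  assumes "x \<in> space M" "y \<in> space M"
  shows "energy_density (U f) (U g) (x, y) = (a x)\<^sup>2 * ((a y)\<^sup>2 * transported_density f g (h x, h y))"
proof -
  have "a x > 0" "a y > 0" using assms by (auto simp: a_pos)
  then show ?thesis
    using assms
    by (simp add: energy_density_def U_def transported_density_def target_weight_def kh conformal power2_eq_square)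
qed

lemma U_log_form:
  assumes [measurable]: "f \<in> borel_measurable M" "g \<in> borel_measurable M"
  shows "log_form n d M (U f) (U g) = 1 / 2 * (LINT x|M. (LINT y|M. transported_density f g (x, y)))"
proof -
  note transported_density_measurable[OF assms, measurable]
  have "(LINT x|M. (LINT y|M. energy_density (U f) (U g) (x, y))) =
        (LINT x|M. (LINT y|M. (a x)\<^sup>2 * ((a y)\<^sup>2 * transported_density f g (h x, h y))))"
    by (intro Bochner_Integration.integral_cong refl) (rule U_energy_density_eq)
  also have "\<dots> = (LINT x|M. (a x)\<^sup>2 * (LINT y|M. transported_density f g (h x, y)))"
  proof (intro Bochner_Integration.integral_cong refl)
    fix x assume x: "x \<in> space M"
    have [measurable]: "(\<lambda>y. transported_density f g (h x, y)) \<in> borel_measurable M"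
      using transported_density_measurable[OF assms] h_space[OF x] by measurable
    show "(LINT y|M. (a x)\<^sup>2 * ((a y)\<^sup>2 * transported_density f g (h x, h y))) = (a x)\<^sup>2 * (LINT y|M. transported_density f g (h x, y))"
      using integral_transport(1)[of "\<lambda>y. transported_density f g (h x, y)"] by simp
  qed
  also have "\<dots> = (LINT x|M. (LINT y|M. transported_density f g (x, y)))"
    by (rule integral_transport(1)) measurable
  finally show ?thesis
    by (simp add: log_form_def energy_density_def)
qed

lemma U_dom:
  assumes f: "f \<in> log_form_dom n d M"
  shows "U f \<in> log_form_dom n d M"
proof -
  have fL: "f \<in> L2_space M" using f by (rule log_form_dom_L2)
  then have [measurable]: "f \<in> borel_measurable M" by (rule L2_space_measurable)
  note transported_density_measurable[OF this this, measurable]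
  have "(\<integral>\<^sup>+x. (\<integral>\<^sup>+y. ennreal (\<bar>U f x - U f y\<bar>\<^sup>2 / d x y ^ n) \<partial>M) \<partial>M) =
        (\<integral>\<^sup>+x. (\<integral>\<^sup>+y. ennreal ((a x)\<^sup>2) * (ennreal ((a y)\<^sup>2) * ennreal (norm (transported_density f f (h x, h y)))) \<partial>M) \<partial>M)"
  proof (intro nn_integral_cong)
    fix x y assume xy: "x \<in> space M" "y \<in> space M"
    have "\<bar>U f x - U f y\<bar>\<^sup>2 / d x y ^ n = \<bar>energy_density (U f) (U f) (x, y)\<bar>"
      by (simp add: energy_density_def d_nonneg power2_eq_square abs_mult)
    also have "\<dots> = (a x)\<^sup>2 * ((a y)\<^sup>2 * norm (transported_density f f (h x, h y)))"
      using xy by (simp add: U_energy_density_eq abs_mult)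
    finally show "ennreal (\<bar>U f x - U f y\<bar>\<^sup>2 / d x y ^ n) =
       ennreal ((a x)\<^sup>2) * (ennreal ((a y)\<^sup>2) * ennreal (norm (transported_density f f (h x, h y))))"
      by (simp flip: ennreal_mult)
  qed
  also have "\<dots> = (\<integral>\<^sup>+x. ennreal ((a x)\<^sup>2) * (\<integral>\<^sup>+y. ennreal (norm (transported_density f f (h x, y))) \<partial>M) \<partial>M)"
  proof (intro nn_integral_cong)
    fix x assume x: "x \<in> space M"
    have [measurable]: "(\<lambda>y. transported_density f f (h x, y)) \<in> borel_measurable M"
      using h_space[OF x] by measurable
    show "(\<integral>\<^sup>+y. ennreal ((a x)\<^sup>2) * (ennreal ((a y)\<^sup>2) * ennreal (norm (transported_density f f (h x, h y)))) \<partial>M) =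
          ennreal ((a x)\<^sup>2) * (\<integral>\<^sup>+y. ennreal (norm (transported_density f f (h x, y))) \<partial>M)"
      using nn_integral_transport[of "\<lambda>y. ennreal (norm (transported_density f f (h x, y)))"] x h_space[OF x]
      by (subst nn_integral_cmult) auto
  qed
  also have "\<dots> = (\<integral>\<^sup>+x. (\<integral>\<^sup>+y. ennreal (norm (transported_density f f (x, y))) \<partial>M) \<partial>M)"
    by (rule nn_integral_transport) measurable
  also have "\<dots> = (\<integral>\<^sup>+z. ennreal (norm (transported_density f f z)) \<partial>(M \<Otimes>\<^sub>M M))"
    by (rule nn_integral_fst) measurable
  also have "\<dots> < \<infinity>"
    using transported_density_integral(1)[OF f f] by (simp add: integrable_iff_bounded)
  finally show ?thesis
    using U_L2[OF fL] by (simp add: log_form_dom_def)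
qed

text \<open>
  The key identity, by substituting \<open>h\<close> in both variables: the form is invariant under the unitary up
  to a bounded potential.
\<close>
lemma U_form:
  assumes f: "f \<in> log_form_dom n d M" and g: "g \<in> log_form_dom n d M"
  shows "log_form n d M (U f) (U g) = log_form n d M f g + (LINT x|M. potential x * (f x * g x))"
proof -
  have "log_form n d M (U f) (U g) = 1 / 2 * (LINT x|M. (LINT y|M. transported_density f g (x, y)))"
    using f g by (intro U_log_form) (auto intro: L2_space_measurable log_form_dom_L2)
  also have "\<dots> = 1 / 2 * (LINT z|(M \<Otimes>\<^sub>M M). transported_density f g z)"
    using MM.integral_fst'[OF transported_density_integral(1)[OF f g]] by simp
  finally show ?thesis
    using transported_density_integral(2)[OF f g] by simp
qed

lemma U_surj_dom:
  assumes g: "g \<in> log_form_dom n d M"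
  obtains g' where "g' \<in> log_form_dom n d M" "\<And>x. x \<in> space M \<Longrightarrow> U g' x = g x"
proof -
  interpret inv: conformal_transport M n d k h "\<lambda>x. 1 / a (k x)" C
    by (rule inverse_transport)
  show thesis
  proof
    show "inv.U g \<in> log_form_dom n d M" by (rule inv.U_dom[OF g])
    show "U (inv.U g) x = g x" if "x \<in> space M" for x
      using that a_pos[OF that] by (simp add: U_def inv.U_def kh)
  qed
qed

lemma potential_mult_L2: "f \<in> L2_space M \<Longrightarrow> (\<lambda>x. potential x * f x) \<in> L2_space M"
  and potential_mult_norm: "f \<in> L2_space M \<Longrightarrow> L2_norm M (\<lambda>x. potential x * f x) \<le> max C 0 * L2_norm M f"
  using potential_bound L2_space_bounded_mult[of f M potential "max C 0"] by auto

text \<open>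
  Testing against \<open>g = U g'\<close> and moving \<open>U\<close> to the other side turns the key identity into a
  statement about resolvents: on operators it reads \<open>\<Delta> U u = U (\<Delta> u + potential * u)\<close>.
\<close>
lemma U_resolvent:
  assumes res: "is_log_resolvent n d M f u"
  shows "is_log_resolvent n d M (U (\<lambda>x. f x + potential x * u x)) (U u)"
proof -
  have f: "f \<in> L2_space M" and u: "u \<in> log_form_dom n d M"
    and eq: "\<And>g. g \<in> log_form_dom n d M \<Longrightarrow> L2_inner M u g + log_form n d M u g = L2_inner M f g"
    using res by (auto simp: is_log_resolvent_def)
  have uL: "u \<in> L2_space M" using u by (rule log_form_dom_L2)
  have \<phi>: "(\<lambda>x. f x + potential x * u x) \<in> L2_space M"
    using f uL by (intro L2_space_add potential_mult_L2)
  have "L2_inner M (U u) g + log_form n d M (U u) g = L2_inner M (U (\<lambda>x. f x + potential x * u x)) g"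
    if g: "g \<in> log_form_dom n d M" for g
  proof -
    obtain g' where g': "g' \<in> log_form_dom n d M" and Ug': "\<And>x. x \<in> space M \<Longrightarrow> U g' x = g x"
      using U_surj_dom[OF g] by metis
    have g'L: "g' \<in> L2_space M" using g' by (rule log_form_dom_L2)
    have "L2_inner M (U u) g + log_form n d M (U u) g = L2_inner M (U u) (U g') + log_form n d M (U u) (U g')"
      by (simp add: L2_inner_cong[OF refl Ug'] log_form_cong[OF refl Ug'])
    also have "\<dots> = L2_inner M f g' + (LINT x|M. potential x * (u x * g' x))"
      using eq[OF g'] by (simp add: U_inner uL g'L U_form u g')
    also have "\<dots> = (LINT x|M. f x * g' x + potential x * u x * g' x)"
      using f g'L potential_mult_L2[OF uL]
      by (simp add: L2_inner_def L2_space_integrable_mult mult.assoc[symmetric])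
    also have "\<dots> = L2_inner M (\<lambda>x. f x + potential x * u x) g'"
      by (simp add: L2_inner_def algebra_simps)
    also have "\<dots> = L2_inner M (U (\<lambda>x. f x + potential x * u x)) (U g')"
      by (simp add: U_inner \<phi> g'L)
    also have "\<dots> = L2_inner M (U (\<lambda>x. f x + potential x * u x)) g"
      by (rule L2_inner_cong[OF refl Ug'])
    finally show ?thesis .
  qed
  then show ?thesis
    using U_dom[OF u] U_L2[OF \<phi>] by (simp add: is_log_resolvent_def)
qed

lemma log_resolvent_unique:
  assumes sep: "\<And>f. f \<in> L2_space M \<Longrightarrow> \<forall>g\<in>log_form_dom n d M. L2_inner M f g = 0 \<Longrightarrow> AE x in M. f x = 0"
    and r: "is_log_resolvent n d M f u" "is_log_resolvent n d M f' u"
  shows "AE x in M. f x = f' x"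
proof -
  have f: "f \<in> L2_space M" "f' \<in> L2_space M"
    using r by (auto simp: is_log_resolvent_def)
  have "L2_inner M (\<lambda>x. f x - f' x) g = 0" if "g \<in> log_form_dom n d M" for g
  proof -
    have "L2_inner M f g = L2_inner M f' g"
      using r that by (auto simp: is_log_resolvent_def)
    then show ?thesis
      using f log_form_dom_L2[OF that]
      by (simp add: L2_inner_def left_diff_distrib L2_space_integrable_mult)
  qed
  then have "AE x in M. f x - f' x = 0"
    using sep[of "\<lambda>x. f x - f' x"] f by (auto intro: L2_space_diff)
  then show ?thesis by simp
qed

text \<open>
  The hypothesis \<open>sep\<close>, density of the form domain, makes the Laplacian well defined up to null
  sets, so that the preimage found in \<open>U_resolvent\<close> agrees with the one selected by the choice
  operator.  The operator \<open>W\<close> may differ from \<open>U\<close> off the space of the measure.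
\<close>
theorem bounded_commutator:
  assumes sep: "\<And>f. f \<in> L2_space M \<Longrightarrow> \<forall>g\<in>log_form_dom n d M. L2_inner M f g = 0 \<Longrightarrow> AE x in M. f x = 0"
    and W: "\<And>f x. x \<in> space M \<Longrightarrow> W f x = a x * f (h x)"
  shows "\<forall>u\<in>log_laplacian_dom n d M. W u \<in> log_laplacian_dom n d M"
    and "\<exists>T. L2_bounded_operator M T \<and> (\<forall>u\<in>log_laplacian_dom n d M.
      AE x in M. T u x = log_laplacian n d M (W u) x - W (log_laplacian n d M u) x)"
proof -
  have W_U: "U f x = W f x" if "x \<in> space M" for f x
    using W[OF that] by (simp add: U_def)
  show dom: "\<forall>u\<in>log_laplacian_dom n d M. W u \<in> log_laplacian_dom n d M"
  proof
    fix u assume "u \<in> log_laplacian_dom n d M"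
    then show "W u \<in> log_laplacian_dom n d M"
      using is_log_resolvent_cong[OF U_resolvent W_U] unfolding log_laplacian_dom_def by blast
  qed
  let ?T = "\<lambda>f. U (\<lambda>x. potential x * f x)"
  have "L2_bounded_operator M ?T"
    unfolding L2_bounded_operator_def
  proof (intro conjI ballI allI)
    fix f assume f: "f \<in> L2_space M"
    then show "?T f \<in> L2_space M" by (intro U_L2 potential_mult_L2)
  next
    fix f g :: "'a \<Rightarrow> real" and \<alpha> \<beta> :: real
    show "AE x in M. ?T (\<lambda>y. \<alpha> * f y + \<beta> * g y) x = \<alpha> * ?T f x + \<beta> * ?T g x"
      by (simp add: U_def algebra_simps)
  next
    have "L2_norm M (?T f) \<le> max C 0 * L2_norm M f" if "f \<in> L2_space M" for f
      using potential_mult_norm[OF that] potential_mult_L2[OF that] by (simp add: L2_norm_def U_inner)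
    then show "\<exists>C. \<forall>f\<in>L2_space M. L2_norm M (?T f) \<le> C * L2_norm M f" by blast
  qed
  moreover have "AE x in M. ?T u x = log_laplacian n d M (W u) x - W (log_laplacian n d M u) x"
    if u: "u \<in> log_laplacian_dom n d M" for u
  proof -
    define f where "f = (SOME f. is_log_resolvent n d M f u)"
    have f: "is_log_resolvent n d M f u"
      using u unfolding f_def log_laplacian_dom_def mem_Collect_eq by (rule someI_ex)
    define g where "g = (SOME f. is_log_resolvent n d M f (W u))"
    have g: "is_log_resolvent n d M g (W u)"
      using dom[rule_format, OF u] unfolding g_def log_laplacian_dom_def mem_Collect_eq
      by (rule someI_ex)
    have "is_log_resolvent n d M (U (\<lambda>x. f x + potential x * u x)) (W u)"
      using U_resolvent[OF f] W_U
      by (rule is_log_resolvent_cong)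
    then have "AE x in M. g x = U (\<lambda>x. f x + potential x * u x) x"
      by (intro log_resolvent_unique[OF _ g] sep)
    then show ?thesis
    proof (rule AE_mp, intro AE_I2 impI)
      fix x assume x: "x \<in> space M" and "g x = U (\<lambda>x. f x + potential x * u x) x"
      then show "?T u x = log_laplacian n d M (W u) x - W (log_laplacian n d M u) x"
        by (simp add: log_laplacian_def W_U[symmetric] f_def[symmetric] g_def[symmetric] U_def algebra_simps)
    qed
  qed
  ultimately show "\<exists>T. L2_bounded_operator M T \<and> (\<forall>u\<in>log_laplacian_dom n d M.
      AE x in M. T u x = log_laplacian n d M (W u) x - W (log_laplacian n d M u) x)"
    by blast
qed

end

section \<open>Volume distortion of radially extended conformal maps\<close>

lemma Basis_vec_axis: "(Basis :: (real ^ 'k::finite) set) = range (\<lambda>i. axis i 1)"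
  by (auto simp: Basis_vec_def)

text \<open>
  The matrix in question is \<open>\<alpha> I + \<beta> u u\<^sup>T\<close>; a rotation that carries the unit vector \<open>u\<close> to a coordinate
  axis makes it diagonal.
\<close>
lemma det_scalar_plus_rank_one:
  fixes u :: "real ^ 'k::finite"
  assumes u: "norm u = 1"
  shows "det (\<chi> i j. (if i = j then \<alpha> else 0) + \<beta> * u $ i * u $ j :: real ^ 'k ^ 'k) =
         \<alpha> ^ (CARD('k) - 1) * (\<alpha> + \<beta>)"
proof -
  let ?G = "\<chi> i j. (if i = j then \<alpha> else 0) + \<beta> * u $ i * u $ j :: real ^ 'k ^ 'k"
  obtain k :: 'k where True by simp
  obtain f :: "real ^ 'k \<Rightarrow> real ^ 'k" where f: "orthogonal_transformation f" "f u = axis k 1"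
    using orthogonal_transformation_exists_1[OF u norm_axis_1] by blast
  define A where "A = matrix f"
  have lin: "linear f" using f(1) by (simp add: orthogonal_transformation_def)
  have A: "A *v x = f x" for x
    unfolding A_def using lin by (simp add: matrix_works linear_linear)
  have orth: "orthogonal_matrix A"
    using f(1) by (simp add: A_def orthogonal_transformation_matrix)
  have Gv: "?G *v x = \<alpha> *\<^sub>R x + (\<beta> * (u \<bullet> x)) *\<^sub>R u" for x
  proof (subst vec_eq_iff, intro allI)
    fix i
    have "(\<Sum>j\<in>UNIV. ((if i = j then \<alpha> else 0) + \<beta> * u $ i * u $ j) * x $ j) =
          (\<Sum>j\<in>UNIV. (if i = j then \<alpha> * x $ j else 0)) + (\<Sum>j\<in>UNIV. \<beta> * u $ i * (u $ j * x $ j))"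
      unfolding sum.distrib[symmetric] by (intro sum.cong) (auto simp: algebra_simps)
    also have "\<dots> = \<alpha> * x $ i + \<beta> * (u \<bullet> x) * u $ i"
      by (simp add: inner_vec_def sum_distrib_left[symmetric])
    finally show "(?G *v x) $ i = (\<alpha> *\<^sub>R x + (\<beta> * (u \<bullet> x)) *\<^sub>R u) $ i"
      by (simp add: matrix_vector_mult_def)
  qed
  let ?D = "A ** ?G ** transpose A"
  have tA: "A *v (x v* A) = x" for x
  proof -
    have "A *v (transpose A *v x) = x"
      unfolding matrix_vector_mul_assoc using orth by (simp add: orthogonal_matrix_def)
    then show ?thesis by simp
  qed
  have inner_tA: "u \<bullet> (x v* A) = x $ k" for x
    using dot_lmul_matrix[of x A u] A[of u] f(2) by (simp add: inner_commute inner_axis)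
  have D: "?D *v x = \<alpha> *\<^sub>R x + (\<beta> * (x $ k)) *\<^sub>R axis k 1" for x
  proof -
    have "?D *v x = A *v (?G *v (x v* A))"
      by (simp only: matrix_vector_mul_assoc[symmetric] transpose_matrix_vector)
    also have "\<dots> = \<alpha> *\<^sub>R (A *v (x v* A)) + (\<beta> * (x $ k)) *\<^sub>R (A *v u)"
      unfolding Gv inner_tA by (simp only: matrix_vector_right_distrib matrix_vector_mult_scaleR)
    finally show ?thesis unfolding tA by (simp only: A f(2))
  qed
  have entries: "?D $ i $ j = (if i = j then (if i = k then \<alpha> + \<beta> else \<alpha>) else 0)" for i j
  proof -
    have "?D $ i $ j = (?D *v axis j 1) $ i"
      by (simp add: matrix_vector_mul_component inner_axis)
    then show ?thesis unfolding D by (simp add: axis_def)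
  qed
  have "det ?D = (\<Prod>i\<in>UNIV. (if i = k then \<alpha> + \<beta> else \<alpha>))"
    by (subst det_diagonal) (auto simp: entries)
  also have "\<dots> = (\<alpha> + \<beta>) * (\<Prod>i\<in>UNIV - {k}. (if i = k then \<alpha> + \<beta> else \<alpha>))"
    by (subst prod.remove[of UNIV k]) auto
  also have "(\<Prod>i\<in>UNIV - {k}. (if i = k then \<alpha> + \<beta> else \<alpha>)) = (\<Prod>i\<in>UNIV - {k}. \<alpha>)"
    by (intro prod.cong) auto
  also have "\<dots> = \<alpha> ^ (CARD('k) - 1)"
    by (simp add: card_Diff_singleton)
  finally have "det ?D = \<alpha> ^ (CARD('k) - 1) * (\<alpha> + \<beta>)" by simp
  moreover have "det ?D = det ?G"
    using det_orthogonal_matrix[OF orth] by (auto simp: det_mul)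
  ultimately show ?thesis by simp
qed

text \<open>
  The Gram condition says that \<open>D\<close> is an isometry on the line of \<open>u\<close>, scales the orthogonal complement
  by \<open>s\<close>, and keeps the two images orthogonal.  This is the shape of the derivative of
  \<open>x \<mapsto> \<parallel>x\<parallel> h (x / \<parallel>x\<parallel>)\<close> for a conformal self-map \<open>h\<close> of the sphere with \<open>s = \<bar>h'\<bar>\<close> and \<open>u\<close> the
  radial direction.
\<close>
lemma abs_det_conformal_off_axis:
  fixes D :: "real ^ 'k::finite \<Rightarrow> real ^ 'k"
  assumes lin: "linear D" and u: "norm u = 1" and s: "0 < s"
    and gram: "\<And>v w. D v \<bullet> D w = s\<^sup>2 * (v \<bullet> w) + (1 - s\<^sup>2) * (u \<bullet> v) * (u \<bullet> w)"
  shows "\<bar>det (matrix D)\<bar> = s ^ (CARD('k) - 1)"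
proof -
  have G: "transpose (matrix D) ** matrix D =
        (\<chi> i j. (if i = j then s\<^sup>2 else 0) + (1 - s\<^sup>2) * u $ i * u $ j)"
  proof (subst vec_eq_iff, intro allI, subst vec_eq_iff, intro allI)
    fix i j
    have "(transpose (matrix D) ** matrix D) $ i $ j = D (axis i 1) \<bullet> D (axis j 1)"
      by (simp add: matrix_matrix_mult_def transpose_def matrix_def inner_vec_def)
    also have "\<dots> = (\<chi> i j. (if i = j then s\<^sup>2 else 0) + (1 - s\<^sup>2) * u $ i * u $ j) $ i $ j"
      unfolding gram by (simp add: inner_axis) (simp add: axis_def)
    finally show "(transpose (matrix D) ** matrix D) $ i $ j =
      (\<chi> i j. (if i = j then s\<^sup>2 else 0) + (1 - s\<^sup>2) * u $ i * u $ j) $ i $ j" .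
  qed
  have "(det (matrix D))\<^sup>2 = det (transpose (matrix D) ** matrix D)"
    by (simp add: det_mul det_transpose power2_eq_square)
  also have "\<dots> = (s ^ (CARD('k) - 1))\<^sup>2"
    unfolding G det_scalar_plus_rank_one[OF u] by (simp add: power_mult[symmetric] mult.commute)
  finally show ?thesis
    using s by (auto simp: power2_eq_iff)
qed

lemma emeasure_image_conformal_off_axis_wellorder:
  fixes H :: "real ^ 'k::{finite,wellorder} \<Rightarrow> real ^ 'k::_"
  assumes S[measurable]: "S \<in> sets borel" and "bounded S"
    and HS[measurable]: "H ` S \<in> sets borel"
    and der: "\<And>x. x \<in> S \<Longrightarrow> (H has_derivative D x) (at x)"
    and inj: "inj_on H S"
    and s_meas[measurable]: "s \<in> borel_measurable borel"
    and s: "\<And>x. x \<in> S \<Longrightarrow> 0 < s x" "\<And>x. x \<in> S \<Longrightarrow> s x \<le> c"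
    and u: "\<And>x. x \<in> S \<Longrightarrow> norm (u x) = 1"
    and gram: "\<And>x v w. x \<in> S \<Longrightarrow>
       D x v \<bullet> D x w = (s x)\<^sup>2 * (v \<bullet> w) + (1 - (s x)\<^sup>2) * (u x \<bullet> v) * (u x \<bullet> w)"
  shows "emeasure lborel (H ` S) = (\<integral>\<^sup>+x\<in>S. ennreal (s x ^ (CARD('k) - 1)) \<partial>lborel)"
proof -
  let ?p = "CARD('k) - 1"
  have det: "\<bar>det (matrix (D x))\<bar> = s x ^ ?p" if "x \<in> S" for x
    using der[OF that] u[OF that] s(1)[OF that] gram[OF that]
    by (intro abs_det_conformal_off_axis) (auto intro: has_derivative_linear)
  have fin: "emeasure lborel S < \<infinity>"
    using \<open>bounded S\<close> by (rule emeasure_bounded_finite)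
  have int: "set_integrable lborel S (\<lambda>x. s x ^ ?p)"
    unfolding set_integrable_def
  proof (rule Bochner_Integration.integrable_bound)
    show "integrable lborel (\<lambda>x. c ^ ?p * indicator S x)"
      using fin by simp
    show "AE x in lborel. norm (indicator S x *\<^sub>R s x ^ ?p) \<le> norm (c ^ ?p * indicator S x)"
    proof (rule AE_I2)
      fix x
      have "s x ^ ?p \<le> c ^ ?p" "0 \<le> s x ^ ?p" if "x \<in> S"
        using s[OF that] by (auto intro: power_mono)
      then show "norm (indicator S x *\<^sub>R s x ^ ?p) \<le> norm (c ^ ?p * indicator S x)"
        by (auto simp: indicator_def)
    qed
  qed measurable
  note I = set_borel_integral_eq_integral[OF int]
  have intdet: "(\<lambda>x. \<bar>det (matrix (D x))\<bar>) integrable_on S"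
    using I(1) by (rule integrable_eq) (simp add: det)
  have derS: "(H has_derivative D x) (at x within S)" if "x \<in> S" for x
    using der[OF that] by (rule has_derivative_at_withinI)
  have Sl: "S \<in> sets lebesgue" using S by auto
  have "H ` S \<in> lmeasurable"
    using measurable_differentiable_image_eq[OF Sl derS inj] intdet by simp
  then have "emeasure lebesgue (H ` S) = ennreal (measure lebesgue (H ` S))"
    by (rule emeasure_eq_measure2)
  then have "emeasure lborel (H ` S) = ennreal (measure lebesgue (H ` S))"
    using HS by simp
  also have "measure lebesgue (H ` S) = integral S (\<lambda>x. \<bar>det (matrix (D x))\<bar>)"
    by (rule measure_differentiable_image_eq[OF Sl derS inj intdet])
  also have "\<dots> = integral S (\<lambda>x. s x ^ ?p)"
    by (rule integral_cong) (simp add: det)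
  also have "\<dots> = (LINT x:S|lborel. s x ^ ?p)"
    using I(2) by simp
  also have "ennreal \<dots> = (\<integral>\<^sup>+x. ennreal (indicator S x * s x ^ ?p) \<partial>lborel)"
    unfolding set_lebesgue_integral_def
  proof (subst nn_integral_eq_integral)
    show "integrable lborel (\<lambda>x. indicator S x * s x ^ ?p)"
      using int by (simp add: set_integrable_def)
    have "0 \<le> s x ^ ?p" if "x \<in> S" for x
      using s(1)[OF that] by simp
    then show "AE x in lborel. 0 \<le> indicator S x * s x ^ ?p"
      by (simp add: indicator_def)
  qed simp
  also have "\<dots> = (\<integral>\<^sup>+x\<in>S. ennreal (s x ^ ?p) \<partial>lborel)"
    by (intro nn_integral_cong) (auto simp: indicator_def)
  finally show ?thesis .
qed

text \<open>
  The change of variables formula is formulated for coordinates indexed by a well-ordered finite type.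
  A copy of the finite type \<open>'m\<close> inside the natural numbers supplies the order, and relabelling
  coordinates is an isometry that preserves Lebesgue measure.
\<close>
typedef ('m::finite) ix = "{..<CARD('m)}"
  by (intro exI[of _ 0]) (simp add: zero_less_card_finite)

instance ix :: (finite) finite
proof
  have "finite (Abs_ix ` {..<CARD('a)} :: 'a ix set)" by simp
  moreover have "Abs_ix ` {..<CARD('a)} = (UNIV :: 'a ix set)"
    by (metis type_definition.Abs_image type_definition_ix)
  ultimately show "finite (UNIV :: 'a ix set)" by simp
qed

instantiation ix :: (finite) wellorder
begin
definition "i \<le> j \<longleftrightarrow> Rep_ix i \<le> Rep_ix j"
definition "i < j \<longleftrightarrow> Rep_ix i < Rep_ix j"
instance
proof
  fix i j l :: "'a ix"
  show "(i < j) = (i \<le> j \<and> \<not> j \<le> i)" unfolding less_eq_ix_def less_ix_def by linarith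
  show "i \<le> i" unfolding less_eq_ix_def by simp
  show "i \<le> j \<Longrightarrow> j \<le> l \<Longrightarrow> i \<le> l" unfolding less_eq_ix_def by linarith
  show "i \<le> j \<Longrightarrow> j \<le> i \<Longrightarrow> i = j" unfolding less_eq_ix_def Rep_ix_inject[symmetric] by linarith
  show "i \<le> j \<or> j \<le> i" unfolding less_eq_ix_def by linarith
next
  fix P :: "'a ix \<Rightarrow> bool" and i
  assume step: "\<And>x. (\<And>y. y < x \<Longrightarrow> P y) \<Longrightarrow> P x"
  show "P i"
  proof (induction i rule: measure_induct_rule[of Rep_ix])
    case (less x)
    show ?case by (rule step, rule less) (simp add: less_ix_def)
  qed
qed
end

lemma card_ix: "CARD('m::finite ix) = CARD('m)"
  using type_definition.card[OF type_definition_ix[where ?'m='m]] by simp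

definition ix_of :: "'m::finite \<Rightarrow> 'm ix" where
  "ix_of = (SOME e. bij e)"

lemma bij_ix_of: "bij (ix_of :: 'm::finite \<Rightarrow> 'm ix)"
proof -
  have "\<exists>e :: 'm \<Rightarrow> 'm ix. bij e"
    using finite_same_card_bij[of "UNIV :: 'm set" "UNIV :: 'm ix set"] by (simp add: card_ix)
  then show ?thesis unfolding ix_of_def by (rule someI_ex)
qed

lemma inv_ix_of [simp]: "inv ix_of (ix_of i) = i" "ix_of (inv ix_of j) = j"
  by (rule inv_f_f[OF bij_is_inj[OF bij_ix_of]], rule surj_f_inv_f[OF bij_is_surj[OF bij_ix_of]])

definition to_ix :: "real ^ 'm \<Rightarrow> real ^ ('m::finite ix)" where
  "to_ix x = (\<chi> i. x $ inv ix_of i)"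

definition of_ix :: "real ^ ('m ix) \<Rightarrow> real ^ ('m::finite)" where
  "of_ix y = (\<chi> j. y $ ix_of j)"

lemma of_to_ix [simp]: "of_ix (to_ix x) = x"
  by (simp add: of_ix_def to_ix_def vec_eq_iff)

lemma to_of_ix [simp]: "to_ix (of_ix x) = x"
  by (simp add: of_ix_def to_ix_def vec_eq_iff)

lemma linear_to_ix: "linear to_ix"
  by (rule linearI) (simp_all add: to_ix_def vec_eq_iff)

lemma linear_of_ix: "linear of_ix"
  by (rule linearI) (simp_all add: of_ix_def vec_eq_iff)

lemma inner_of_ix [simp]: "of_ix x \<bullet> of_ix y = x \<bullet> y"
  unfolding inner_vec_def of_ix_def
  using sum.reindex_bij_betw[of ix_of UNIV UNIV "\<lambda>i. x $ i \<bullet> y $ i"] bij_ix_of by simp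

lemma inner_to_ix [simp]: "to_ix x \<bullet> to_ix y = x \<bullet> y"
  using inner_of_ix[of "to_ix x" "to_ix y"] by (simp del: inner_of_ix)

lemma measurable_to_ix[measurable]: "to_ix \<in> borel_measurable borel"
  and measurable_of_ix[measurable]: "of_ix \<in> borel_measurable borel"
  using linear_to_ix linear_of_ix
  by (auto intro!: borel_measurable_continuous_onI linear_continuous_on simp: linear_linear)

lemma lborel_to_ix: "distr lborel borel to_ix = (lborel :: (real ^ ('m::finite ix)) measure)"
proof (rule lborel_eqI[symmetric])
  fix l u :: "real ^ ('m ix)"
  assume le: "\<And>b. b \<in> Basis \<Longrightarrow> l \<bullet> b \<le> u \<bullet> b"
  have le': "l $ i \<le> u $ i" for i
    using le[of "axis i 1"] by (simp add: Basis_vec_axis inner_axis)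
  have prod: "(\<Prod>b\<in>Basis. x \<bullet> b) = (\<Prod>i\<in>UNIV. x $ i)" for x :: "real ^ 'k::finite"
    unfolding Basis_vec_axis
    by (subst prod.reindex) (auto simp: inj_on_def axis_eq_axis inner_axis)
  have box: "to_ix -` box l u = box (of_ix l) (of_ix u)"
  proof (intro set_eqI)
    fix x
    have "(\<forall>i. l $ i < to_ix x $ i \<and> to_ix x $ i < u $ i) \<longleftrightarrow>
       (\<forall>j. l $ ix_of j < x $ j \<and> x $ j < u $ ix_of j)"
      unfolding to_ix_def vec_lambda_beta by (metis inv_ix_of)
    then show "x \<in> to_ix -` box l u \<longleftrightarrow> x \<in> box (of_ix l) (of_ix u)"
      by (simp add: mem_box_cart of_ix_def)
  qed
  have "emeasure (distr lborel borel to_ix) (box l u) = emeasure lborel (box (of_ix l) (of_ix u))"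
    by (simp add: emeasure_distr box)
  also have "\<dots> = (\<Prod>b\<in>Basis. (of_ix u - of_ix l) \<bullet> b)"
    by (rule emeasure_lborel_box) (auto simp: Basis_vec_axis inner_axis of_ix_def le')
  also have "(\<Prod>b\<in>Basis. (of_ix u - of_ix l) \<bullet> b) = (\<Prod>j\<in>UNIV. (u - l) $ ix_of j)"
    unfolding prod by (simp add: of_ix_def)
  also have "\<dots> = (\<Prod>i\<in>UNIV. (u - l) $ i)"
    using prod.reindex_bij_betw[of ix_of UNIV UNIV "\<lambda>i. (u - l) $ i"] bij_ix_of by simp
  finally show "emeasure (distr lborel borel to_ix) (box l u) = (\<Prod>b\<in>Basis. (u - l) \<bullet> b)"
    unfolding prod .
qed simp

lemma emeasure_image_conformal_off_axis:
  fixes H :: "real ^ 'm::finite \<Rightarrow> real ^ 'm"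
  assumes S[measurable]: "S \<in> sets borel" and "bounded S"
    and HS[measurable]: "H ` S \<in> sets borel"
    and der: "\<And>x. x \<in> S \<Longrightarrow> (H has_derivative D x) (at x)"
    and inj: "inj_on H S"
    and s_meas[measurable]: "s \<in> borel_measurable borel"
    and s: "\<And>x. x \<in> S \<Longrightarrow> 0 < s x" "\<And>x. x \<in> S \<Longrightarrow> s x \<le> c"
    and u: "\<And>x. x \<in> S \<Longrightarrow> norm (u x) = 1"
    and gram: "\<And>x v w. x \<in> S \<Longrightarrow>
       D x v \<bullet> D x w = (s x)\<^sup>2 * (v \<bullet> w) + (1 - (s x)\<^sup>2) * (u x \<bullet> v) * (u x \<bullet> w)"
  shows "emeasure lborel (H ` S) = (\<integral>\<^sup>+x\<in>S. ennreal (s x ^ (CARD('m) - 1)) \<partial>lborel)"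
proof -
  have im: "to_ix ` T = of_ix -` T" for T :: "(real ^ 'm) set"
    by (auto simp: image_iff) (metis to_of_ix)
  have norm: "norm (to_ix x) = norm x" for x :: "real ^ 'm"
    by (simp add: norm_eq_sqrt_inner)
  have im_borel: "to_ix ` T \<in> sets borel" if "T \<in> sets borel" for T :: "(real ^ 'm) set"
    unfolding im using measurable_sets[OF measurable_of_ix that] by simp
  have em: "emeasure lborel (to_ix ` T) = emeasure lborel T" if [measurable]: "T \<in> sets borel" for T :: "(real ^ 'm) set"
  proof -
    have "emeasure lborel (to_ix ` T) = emeasure (distr lborel borel to_ix) (to_ix ` T)"
      by (simp add: lborel_to_ix)
    also have "\<dots> = emeasure lborel (to_ix -` (to_ix ` T))"
      using im_borel[OF that] by (simp add: emeasure_distr)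
    also have "to_ix -` (to_ix ` T) = T"
      by (auto simp: image_iff) (metis of_to_ix)
    finally show ?thesis .
  qed
  let ?S = "to_ix ` S" and ?H = "\<lambda>x. to_ix (H (of_ix x))"
  have HS': "?H ` ?S = to_ix ` (H ` S)"
    by (simp add: image_image)
  have "emeasure lborel (?H ` ?S) =
     (\<integral>\<^sup>+x\<in>?S. ennreal (s (of_ix x) ^ (CARD('m ix) - 1)) \<partial>lborel)"
  proof (rule emeasure_image_conformal_off_axis_wellorder)
    show "?S \<in> sets borel" by (rule im_borel) fact
    show "?H ` ?S \<in> sets borel" unfolding HS' by (rule im_borel) fact
    show "bounded ?S"
      using \<open>bounded S\<close> by (auto simp: bounded_iff norm)
    fix y assume "y \<in> ?S"
    then have x: "of_ix y \<in> S" by auto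
    show "(?H has_derivative (\<lambda>v. to_ix (D (of_ix y) (of_ix v)))) (at y)"
    proof -
      have 1: "(of_ix has_derivative of_ix) (at y)"
        using linear_of_ix by (intro bounded_linear_imp_has_derivative) (simp add: linear_conv_bounded_linear)
      have 2: "(to_ix has_derivative to_ix) (at (H (of_ix y)))"
        using linear_to_ix by (intro bounded_linear_imp_has_derivative) (simp add: linear_conv_bounded_linear)
      show ?thesis
        using has_derivative_compose[OF has_derivative_compose[OF 1 der[OF x]] 2] .
    qed
    show "0 < s (of_ix y)" "s (of_ix y) \<le> c" using s x by auto
    show "norm (to_ix (u (of_ix y))) = 1" using u[OF x] by (simp add: norm)
    have io: "to_ix a \<bullet> b = a \<bullet> of_ix b" for a :: "real ^ 'm" and b
      using inner_to_ix[of a "of_ix b"] by simp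
    show "to_ix (D (of_ix y) (of_ix v)) \<bullet> to_ix (D (of_ix y) (of_ix w)) =
        (s (of_ix y))\<^sup>2 * (v \<bullet> w) + (1 - (s (of_ix y))\<^sup>2) * (to_ix (u (of_ix y)) \<bullet> v) * (to_ix (u (of_ix y)) \<bullet> w)" for v w
      by (simp add: gram[OF x] io)
  next
    show "inj_on ?H ?S"
      using inj by (auto simp: inj_on_def) (metis of_to_ix)
  qed measurable
  also have "\<dots> = (\<integral>\<^sup>+y. ennreal (s (of_ix y) ^ (CARD('m) - 1)) * indicator ?S y \<partial>distr lborel borel to_ix)"
    by (simp add: lborel_to_ix card_ix)
  also have "\<dots> = (\<integral>\<^sup>+x\<in>S. ennreal (s x ^ (CARD('m) - 1)) \<partial>lborel)"
  proof -
    have [measurable]: "?S \<in> sets borel" by (rule im_borel) fact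
    have "to_ix x \<in> ?S \<longleftrightarrow> x \<in> S" for x
      by (metis image_iff of_to_ix)
    then have ind: "indicator ?S (to_ix x) = (indicator S x :: ennreal)" for x
      by (simp add: indicator_def)
    show ?thesis
      by (subst nn_integral_distr) (simp_all add: ind)
  qed
  finally show ?thesis
    unfolding HS' by (simp add: em)
qed

section \<open>Lorentz transformations of the light cone\<close>

definition event :: "real ^ 'm \<Rightarrow> real \<Rightarrow> real ^ ('m::finite option)" where
  "event x t = (\<chi> j. case j of None \<Rightarrow> t | Some i \<Rightarrow> x $ i)"

definition space_part :: "real ^ ('m::finite option) \<Rightarrow> real ^ 'm" where
  "space_part v = (\<chi> i. v $ Some i)"

lemma event_simps [simp]:
  "space_part (event x t) = x" "event x t $ None = t" "event (space_part v) (v $ None) = v"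
  by (auto simp: space_part_def event_def vec_eq_iff split: option.splits)

lemma event_scaleR: "event (c *\<^sub>R x) (c * t) = c *\<^sub>R event x t"
  by (auto simp: event_def vec_eq_iff split: option.splits)

lemma space_part_scaleR: "space_part (c *\<^sub>R v) = c *\<^sub>R space_part v"
  by (simp add: space_part_def vec_eq_iff)

lemma lorentz_form_eq: "lorentz_form v w = space_part v \<bullet> space_part w - v $ None * w $ None"
  by (simp add: lorentz_form_def space_part_def inner_vec_def)

lemma lorentz_form_scaleR: "lorentz_form (c *\<^sub>R v) (e *\<^sub>R w) = c * e * lorentz_form v w"
  by (simp add: lorentz_form_eq space_part_scaleR algebra_simps)

lemma SO_plus_form: "A \<in> SO_plus \<Longrightarrow> lorentz_form (A *v v) (A *v w) = lorentz_form v w"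
  by (simp add: SO_plus_def)

text \<open>
  The time-time entries of \<open>A\<close> and its inverse agree because both equal \<open>- \<langle>A e, e\<rangle>\<close> for the unit
  time vector \<open>e\<close>; this keeps the inverse in the identity component.
\<close>
lemma SO_plus_matrix_inv:
  fixes A :: "real ^ ('m::finite option) ^ ('m option)"
  assumes A: "A \<in> SO_plus"
  shows "matrix_inv A \<in> SO_plus" "A *v (matrix_inv A *v v) = v" "matrix_inv A *v (A *v v) = v"
proof -
  have det: "det A = 1" using A by (simp add: SO_plus_def)
  then have "\<exists>A'. A ** A' = mat 1 \<and> A' ** A = mat 1"
    using invertible_det_nz[of A] unfolding invertible_def by auto
  from someI_ex[OF this] have inv: "A ** matrix_inv A = mat 1" "matrix_inv A ** A = mat 1"
    unfolding matrix_inv_def by auto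
  show 1: "A *v (matrix_inv A *v v) = v" for v
    using inv by (simp add: matrix_vector_mul_assoc)
  show 2: "matrix_inv A *v (A *v v) = v"
    using inv by (simp add: matrix_vector_mul_assoc)
  have form: "lorentz_form (matrix_inv A *v v) (matrix_inv A *v w) = lorentz_form v w" for v w
    using SO_plus_form[OF A, of "matrix_inv A *v v" "matrix_inv A *v w"] by (simp add: 1)
  let ?e = "event 0 1 :: real ^ ('m option)"
  have e: "(B *v ?e) $ None = B $ None $ None" for B :: "real ^ ('m option) ^ ('m option)"
  proof -
    have "?e = axis None 1" by (auto simp: event_def axis_def vec_eq_iff split: option.splits)
    then show ?thesis by (simp only: matrix_vector_mul_component inner_axis) simp
  qed
  have "lorentz_form (A *v ?e) ?e = lorentz_form ?e (matrix_inv A *v ?e)"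
    using SO_plus_form[OF A, of ?e "matrix_inv A *v ?e"] by (simp add: 1)
  then have "matrix_inv A $ None $ None = A $ None $ None"
    by (simp add: lorentz_form_eq e)
  moreover have "det (matrix_inv A) = 1"
    using arg_cong[OF inv(1), of det] det by (simp add: det_mul)
  ultimately show "matrix_inv A \<in> SO_plus"
    using A form by (simp add: SO_plus_def)
qed

text \<open>
  The sphere is the section of the future light cone at time \<open>1\<close>.  Points \<open>x\<close> of the whole ambient
  space are lifted to the light cone as \<open>(x, \<parallel>x\<parallel>)\<close>, which extends the action on the sphere
  to a map of the ambient space that is homogeneous of degree one and preserves the norm.
\<close>
definition light_vec :: "real ^ 'm \<Rightarrow> real ^ ('m::finite option)" where
  "light_vec x = event x (norm x)"

definition cone_time :: "real ^ ('m::finite option) ^ ('m option) \<Rightarrow> real ^ 'm \<Rightarrow> real" where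
  "cone_time A x = (A *v light_vec x) $ None"

definition cone_space :: "real ^ ('m::finite option) ^ ('m option) \<Rightarrow> real ^ 'm \<Rightarrow> real ^ 'm" where
  "cone_space A x = space_part (A *v light_vec x)"

definition cone_map :: "real ^ ('m::finite option) ^ ('m option) \<Rightarrow> real ^ 'm \<Rightarrow> real ^ 'm" where
  "cone_map A x = (norm x / cone_time A x) *\<^sub>R cone_space A x"

text \<open>
  The time component is, up to sign, the Lorentz pairing with \<open>A\<^sup>-\<^sup>1 e\<close>, a future-pointing vector of Lorentz square
  \<open>-1\<close>; its spatial part \<open>b\<close> is therefore shorter than its time component \<open>\<beta>\<close>.
\<close>
lemma cone_time_eq:
  fixes A :: "real ^ ('m::finite option) ^ ('m option)"
  assumes A: "A \<in> SO_plus"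
  obtains \<beta> b where "norm b < \<beta>" "\<And>x. cone_time A x = \<beta> * norm x - b \<bullet> x"
proof
  let ?w = "matrix_inv A *v event 0 1"
  have "lorentz_form ?w ?w = -1"
    using SO_plus_form[OF SO_plus_matrix_inv(1)[OF A]] by (simp add: lorentz_form_eq)
  then have eq: "(norm (space_part ?w))\<^sup>2 = (?w $ None)\<^sup>2 - 1"
    by (simp add: lorentz_form_eq power2_norm_eq_inner) (simp add: power2_eq_square)
  have e: "event 0 1 = axis None (1::real)"
    by (auto simp: event_def axis_def vec_eq_iff split: option.splits)
  have "?w $ None = matrix_inv A $ None $ None"
    unfolding e by (simp add: matrix_vector_mul_component inner_axis)
  then have "?w $ None > 0"
    using SO_plus_matrix_inv(1)[OF A] by (simp add: SO_plus_def)
  with eq show "norm (space_part ?w) < ?w $ None"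
    by (intro power2_less_imp_less[of _ "?w $ None"]) auto
  fix x :: "real ^ 'm"
  have "cone_time A x = - lorentz_form (A *v light_vec x) (event 0 1)"
    by (simp add: lorentz_form_eq cone_time_def)
  also have "\<dots> = - lorentz_form (light_vec x) ?w"
    using SO_plus_form[OF A, of "light_vec x" ?w] by (simp add: SO_plus_matrix_inv(2)[OF A])
  finally show "cone_time A x = ?w $ None * norm x - space_part ?w \<bullet> x"
    by (simp add: lorentz_form_eq light_vec_def inner_commute)
qed

lemma cone_time_bounds:
  fixes A :: "real ^ ('m::finite option) ^ ('m option)"
  assumes A: "A \<in> SO_plus"
  obtains m M L where "0 < m" "\<And>x. m * norm x \<le> cone_time A x" "\<And>x. cone_time A x \<le> M * norm x"
    "\<And>x y. \<bar>cone_time A x - cone_time A y\<bar> \<le> L * dist x y"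
proof -
  obtain \<beta> b where b: "norm b < \<beta>" and eq: "\<And>x. cone_time A x = \<beta> * norm x - b \<bullet> x"
    using cone_time_eq[OF A] by metis
  have le: "\<bar>b \<bullet> x\<bar> \<le> norm b * norm x" for x by (rule Cauchy_Schwarz_ineq2)
  show thesis
  proof
    show "0 < \<beta> - norm b" using b by simp
    show "(\<beta> - norm b) * norm x \<le> cone_time A x" "cone_time A x \<le> (\<beta> + norm b) * norm x" for x
      using le[of x] by (auto simp: eq algebra_simps)
    show "\<bar>cone_time A x - cone_time A y\<bar> \<le> (\<beta> + norm b) * dist x y" for x y
    proof -
      have "cone_time A x - cone_time A y = \<beta> * (norm x - norm y) - b \<bullet> (x - y)"
        by (simp add: eq algebra_simps)
      also have "\<bar>\<dots>\<bar> \<le> \<beta> * \<bar>norm x - norm y\<bar> + norm b * norm (x - y)"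
        using le[of "x - y"] abs_triangle_ineq4[of "\<beta> * (norm x - norm y)" "b \<bullet> (x - y)"] b
          norm_ge_zero[of b] by (simp add: abs_mult)
      also have "\<dots> \<le> \<beta> * norm (x - y) + norm b * norm (x - y)"
        using b norm_ge_zero[of b] by (intro add_right_mono mult_left_mono norm_triangle_ineq3) linarith
      finally show ?thesis by (simp add: dist_norm algebra_simps)
    qed
  qed
qed

lemma cone_time_pos: "A \<in> SO_plus \<Longrightarrow> x \<noteq> 0 \<Longrightarrow> 0 < cone_time A x"
  by (metis cone_time_bounds mult_pos_pos order_less_le_trans zero_less_norm_iff)

lemma lorentz_form_light_vec: "lorentz_form (light_vec x) (light_vec y) = x \<bullet> y - norm x * norm y"
  by (simp add: lorentz_form_eq light_vec_def)

lemma lift_eq: "A *v light_vec x = event (cone_space A x) (cone_time A x)"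
  by (simp add: cone_space_def cone_time_def)

lemma cone_space_inner:
  assumes "A \<in> SO_plus"
  shows "cone_space A x \<bullet> cone_space A y = cone_time A x * cone_time A y + x \<bullet> y - norm x * norm y"
  using SO_plus_form[OF assms, of "light_vec x" "light_vec y"]
  unfolding lift_eq lorentz_form_light_vec by (simp add: lorentz_form_eq)

lemma norm_cone_space:
  assumes "A \<in> SO_plus" "x \<noteq> 0"
  shows "norm (cone_space A x) = cone_time A x"
proof -
  have "(norm (cone_space A x))\<^sup>2 = (cone_time A x)\<^sup>2"
    using cone_space_inner[OF assms(1), of x x]
    unfolding power2_norm_eq_inner[symmetric] by (simp add: power2_eq_square)
  then show ?thesis
    using cone_time_pos[OF assms] by (simp add: power2_eq_iff_nonneg)
qed

lemma norm_cone_map: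
  assumes "A \<in> SO_plus"
  shows "norm (cone_map A x) = norm x"
proof (cases "x = 0")
  case False
  then show ?thesis
    using norm_cone_space[OF assms False] cone_time_pos[OF assms False] by (simp add: cone_map_def)
qed (simp add: cone_map_def)

lemma light_vec_cone_map:
  assumes A: "A \<in> SO_plus" and x: "x \<noteq> 0"
  shows "light_vec (cone_map A x) = (norm x / cone_time A x) *\<^sub>R (A *v light_vec x)"
proof -
  have "norm x = norm x / cone_time A x * cone_time A x"
    using cone_time_pos[OF A x] by simp
  then have "light_vec (cone_map A x) = event ((norm x / cone_time A x) *\<^sub>R cone_space A x) (norm x / cone_time A x * cone_time A x)"
    unfolding light_vec_def norm_cone_map[OF A] by (simp add: cone_map_def)
  then show ?thesis by (simp only: event_scaleR lift_eq)
qed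

lemma cone_map_inverse:
  assumes A: "A \<in> SO_plus" and x: "x \<noteq> 0"
  shows "cone_time (matrix_inv A) (cone_map A x) * cone_time A x = (norm x)\<^sup>2"
    and "cone_map (matrix_inv A) (cone_map A x) = x"
proof -
  let ?r = "norm x / cone_time A x"
  have pos: "cone_time A x > 0" by (rule cone_time_pos[OF A x])
  have *: "matrix_inv A *v light_vec (cone_map A x) = ?r *\<^sub>R light_vec x"
    by (simp add: light_vec_cone_map[OF A x] matrix_vector_mult_scaleR SO_plus_matrix_inv(3)[OF A])
  have t: "cone_time (matrix_inv A) (cone_map A x) = ?r * norm x"
    unfolding cone_time_def[of "matrix_inv A"] * by (simp add: light_vec_def)
  then show "cone_time (matrix_inv A) (cone_map A x) * cone_time A x = (norm x)\<^sup>2"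
    using pos by (simp add: power2_eq_square)
  have s: "cone_space (matrix_inv A) (cone_map A x) = ?r *\<^sub>R x"
    unfolding cone_space_def[of "matrix_inv A"] * by (simp add: light_vec_def space_part_scaleR)
  show "cone_map (matrix_inv A) (cone_map A x) = x"
    using pos x by (simp add: cone_map_def[of "matrix_inv A"] t s norm_cone_map[OF A])
qed

lemma matrix_inv_matrix_inv_SO_plus:
  assumes A: "A \<in> SO_plus"
  shows "matrix_inv (matrix_inv A) = A"
proof -
  have inv: "A ** matrix_inv A = mat 1" "matrix_inv A ** A = mat 1"
    using SO_plus_matrix_inv(2,3)[OF A] by (simp_all add: matrix_eq matrix_vector_mul_assoc[symmetric])
  have "matrix_inv A ** matrix_inv (matrix_inv A) = mat 1"
    using SO_plus_matrix_inv(2)[OF SO_plus_matrix_inv(1)[OF A]]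
    by (simp add: matrix_eq matrix_vector_mul_assoc[symmetric])
  then have "A ** (matrix_inv A ** matrix_inv (matrix_inv A)) = A" by simp
  then show ?thesis by (simp add: matrix_mul_assoc inv)
qed

text \<open>
  On unit vectors the Lorentz product of the lifts is \<open>- \<parallel>x - y\<parallel>\<^sup>2 / 2\<close>, so invariance of the form
  turns the rescaling back to time \<open>1\<close> into the two-point identity of the conformal action.
\<close>
lemma dist_cone_map:
  assumes A: "A \<in> SO_plus" and x: "norm x = 1" and y: "norm y = 1"
  shows "(dist (cone_map A x) (cone_map A y))\<^sup>2 = (dist x y)\<^sup>2 / (cone_time A x * cone_time A y)"
proof -
  have d: "(dist x y)\<^sup>2 = - 2 * lorentz_form (light_vec x) (light_vec y)"
    if "norm x = 1" "norm y = 1" for x y :: "real ^ 'm"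
    using that dot_norm_neg[of x y] by (simp add: lorentz_form_light_vec dist_norm)
  have "x \<noteq> 0" "y \<noteq> 0" using x y by auto
  then show ?thesis
    using x y by (simp add: d norm_cone_map[OF A] light_vec_cone_map[OF A] lorentz_form_scaleR SO_plus_form[OF A])
qed

lemma lorentz_action_sphere:
  assumes A: "A \<in> SO_plus" and x: "norm x = 1"
  shows "lorentz_action A x = cone_map A x"
proof -
  have "ball_lift x = 2 *\<^sub>R light_vec x"
    using x by (auto simp: ball_lift_def light_vec_def event_def vec_eq_iff split: option.splits)
  then have v: "A *v ball_lift x = 2 *\<^sub>R (A *v light_vec x)"
    by (simp add: matrix_vector_mult_scaleR)
  have "lorentz_action A x = space_part (2 *\<^sub>R (A *v light_vec x)) /\<^sub>R (2 * cone_time A x)"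
    using x by (simp add: lorentz_action_def v Let_def space_part_def cone_time_def)
  also have "\<dots> = (2 *\<^sub>R cone_space A x) /\<^sub>R (2 * cone_time A x)"
    by (simp only: space_part_scaleR cone_space_def)
  finally show ?thesis
    using x by (simp add: cone_map_def inverse_eq_divide)
qed

lemma light_vec_scaleR: "0 \<le> r \<Longrightarrow> light_vec (r *\<^sub>R x) = r *\<^sub>R light_vec x"
  by (simp add: light_vec_def flip: event_scaleR)

lemma cone_scaleR:
  assumes "0 < r"
  shows "cone_time A (r *\<^sub>R x) = r * cone_time A x"
    and "cone_map A (r *\<^sub>R x) = r *\<^sub>R cone_map A x"
proof -
  show t: "cone_time A (r *\<^sub>R x) = r * cone_time A x"
    using assms by (simp add: cone_time_def light_vec_scaleR matrix_vector_mult_scaleR)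
  have "cone_space A (r *\<^sub>R x) = r *\<^sub>R cone_space A x"
    using assms by (simp add: cone_space_def light_vec_scaleR matrix_vector_mult_scaleR space_part_scaleR)
  then show "cone_map A (r *\<^sub>R x) = r *\<^sub>R cone_map A x"
    using assms by (simp add: cone_map_def t)
qed

lemma sgn_cone_map:
  assumes A: "A \<in> SO_plus"
  shows "sgn (cone_map A x) = cone_map A (sgn x)"
proof (cases "x = 0")
  case False
  then show ?thesis
    by (simp add: sgn_div_norm norm_cone_map[OF A] cone_scaleR)
qed (simp add: cone_map_def)

definition cone_map_derivative ::
    "real ^ ('m::finite option) ^ ('m option) \<Rightarrow> real ^ 'm \<Rightarrow> real ^ 'm \<Rightarrow> real ^ 'm" where
  "cone_map_derivative A x v =
     (let Y = A *v event v (sgn x \<bullet> v) in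
      ((sgn x \<bullet> v) / cone_time A x - norm x * Y $ None / (cone_time A x)\<^sup>2) *\<^sub>R cone_space A x +
      (norm x / cone_time A x) *\<^sub>R space_part Y)"

lemma bounded_linear_space_part: "bounded_linear space_part"
  unfolding linear_conv_bounded_linear[symmetric] by (rule linearI) (simp_all add: space_part_def vec_eq_iff)

lemma bounded_linear_event: "bounded_linear (\<lambda>(x, t). event x t)"
  unfolding linear_conv_bounded_linear[symmetric] by (rule linearI) (auto simp: event_def vec_eq_iff split: option.splits)

lemma has_derivative_lift:
  assumes x: "x \<noteq> 0"
  shows "((\<lambda>x. A *v light_vec x) has_derivative (\<lambda>v. A *v event v (sgn x \<bullet> v))) (at x)"
proof -
  have 1: "((\<lambda>x. (x, norm x)) has_derivative (\<lambda>v. (v, sgn x \<bullet> v))) (at x)"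
    using has_derivative_norm[OF x] by (intro has_derivative_Pair has_derivative_ident) (simp add: inner_commute)
  have 2: "((\<lambda>x. light_vec x) has_derivative (\<lambda>v. event v (sgn x \<bullet> v))) (at x)"
    using bounded_linear.has_derivative[OF bounded_linear_event 1] by (simp add: light_vec_def[abs_def])
  show ?thesis
    using bounded_linear.has_derivative[OF matrix_vector_mul_bounded_linear[of A] 2] .
qed

lemma has_derivative_cone_map:
  assumes A: "A \<in> SO_plus" and x: "x \<noteq> 0"
  shows "(cone_map A has_derivative cone_map_derivative A x) (at x)"
proof -
  note D = has_derivative_lift[OF x, of A]
  have s: "(cone_space A has_derivative (\<lambda>v. space_part (A *v event v (sgn x \<bullet> v)))) (at x)"
    using bounded_linear.has_derivative[OF bounded_linear_space_part D] unfolding cone_space_def[abs_def] .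
  have t: "(cone_time A has_derivative (\<lambda>v. (A *v event v (sgn x \<bullet> v)) $ None)) (at x)"
    using bounded_linear.has_derivative[OF bounded_linear_vec_nth D] unfolding cone_time_def[abs_def] .
  have n: "(norm has_derivative (\<lambda>v. sgn x \<bullet> v)) (at x)"
    using has_derivative_norm[OF x] by (simp add: inner_commute)
  have pos: "cone_time A x > 0" by (rule cone_time_pos[OF A x])
  have "((\<lambda>x. norm x / cone_time A x) has_derivative (\<lambda>v. ((sgn x \<bullet> v) * cone_time A x -
      norm x * (A *v event v (sgn x \<bullet> v)) $ None) / (cone_time A x * cone_time A x))) (at x)"
    using has_derivative_divide'[OF n t] pos by simp
  from has_derivative_scaleR[OF this s] show ?thesis
    unfolding cone_map_def[abs_def]
  proof (rule has_derivative_eq_rhs)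
    show "(\<lambda>h. (norm x / cone_time A x) *\<^sub>R space_part (A *v event h (sgn x \<bullet> h)) +
        (((sgn x \<bullet> h) * cone_time A x - norm x * (A *v event h (sgn x \<bullet> h)) $ None) /
         (cone_time A x * cone_time A x)) *\<^sub>R cone_space A x) = cone_map_derivative A x"
      using pos by (simp add: fun_eq_iff cone_map_derivative_def Let_def diff_divide_distrib power2_eq_square)
  qed
qed

text \<open>
  Let \<open>Y = (p, q)\<close> be the image of the lift \<open>(x, \<parallel>x\<parallel>)\<close>, so that the map is \<open>s p\<close> with \<open>s q = \<parallel>x\<parallel>\<close>.
  Since \<open>Y\<close> is null, \<open>p \<bullet> p = q\<^sup>2\<close> and \<open>p \<bullet> dp = q dq\<close>; hence
  \<open>d(s p) \<bullet> d(s p)\<close> equals \<open>d(s q)\<^sup>2 + s\<^sup>2 \<langle>dY, dY\<rangle>\<close>, and \<open>\<langle>dY, dY\<rangle>\<close> is the invariant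
  \<open>\<parallel>dx\<parallel>\<^sup>2 - (d\<parallel>x\<parallel>)\<^sup>2\<close>.
\<close>
lemma cone_map_derivative_gram:
  assumes A: "A \<in> SO_plus" and x: "x \<noteq> 0"
  defines "s \<equiv> norm x / cone_time A x"
  shows "cone_map_derivative A x v \<bullet> cone_map_derivative A x w =
     s\<^sup>2 * (v \<bullet> w) + (1 - s\<^sup>2) * (sgn x \<bullet> v) * (sgn x \<bullet> w)"
proof -
  let ?Y = "\<lambda>v. A *v event v (sgn x \<bullet> v)"
  define q where "q = cone_time A x"
  define p where "p = cone_space A x"
  have pos: "q > 0" unfolding q_def by (rule cone_time_pos[OF A x])
  have YY: "space_part (?Y v) \<bullet> space_part (?Y w) =
      ?Y v $ None * ?Y w $ None + v \<bullet> w - (sgn x \<bullet> v) * (sgn x \<bullet> w)" for v w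
    using SO_plus_form[OF A, of "event v (sgn x \<bullet> v)" "event w (sgn x \<bullet> w)"]
    by (simp add: lorentz_form_eq)
  have pY: "p \<bullet> space_part (?Y v) = q * ?Y v $ None" for v
    using SO_plus_form[OF A, of "light_vec x" "event v (sgn x \<bullet> v)"] x
    unfolding lift_eq
    by (simp add: lorentz_form_eq p_def q_def light_vec_def sgn_div_norm mult.assoc[symmetric])
  have pp: "p \<bullet> p = q * q"
    using cone_space_inner[OF A, of x x] by (simp add: p_def q_def power2_norm_eq_inner[symmetric] power2_eq_square)
  define d where "d v = (sgn x \<bullet> v) / q - norm x * ?Y v $ None / q\<^sup>2" for v
  have D: "cone_map_derivative A x v = d v *\<^sub>R p + s *\<^sub>R space_part (?Y v)" for v
    by (simp add: cone_map_derivative_def Let_def d_def p_def q_def s_def)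
  have dq: "d v * q = sgn x \<bullet> v - s * ?Y v $ None" for v
    using pos by (simp add: d_def s_def q_def[symmetric] field_simps power2_eq_square)
  have "cone_map_derivative A x v \<bullet> cone_map_derivative A x w =
      d v * d w * (p \<bullet> p) + s * d v * (p \<bullet> space_part (?Y w)) + s * d w * (p \<bullet> space_part (?Y v))
      + s\<^sup>2 * (space_part (?Y v) \<bullet> space_part (?Y w))"
    by (simp add: D inner_add_left inner_add_right inner_commute power2_eq_square algebra_simps)
  also have "\<dots> = (d v * q + s * ?Y v $ None) * (d w * q + s * ?Y w $ None)
      + s\<^sup>2 * (v \<bullet> w - (sgn x \<bullet> v) * (sgn x \<bullet> w))"
    unfolding pp pY YY by (simp add: power2_eq_square algebra_simps)
  also have "\<dots> = (sgn x \<bullet> v) * (sgn x \<bullet> w) + s\<^sup>2 * (v \<bullet> w - (sgn x \<bullet> v) * (sgn x \<bullet> w))"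
    by (simp add: dq)
  finally show ?thesis by (simp add: algebra_simps)
qed

text \<open>
  A great circle through \<open>x\<close> with velocity \<open>v\<close> detects the value of any derivative at \<open>v\<close>.
\<close>
lemma has_derivative_within_sphere_unique:
  fixes g :: "'a::euclidean_space \<Rightarrow> 'a"
  assumes x: "norm x = 1" and v: "norm v = 1" "v \<bullet> x = 0"
    and D: "(g has_derivative D) (at x within sphere 0 1)"
    and E: "(g has_derivative E) (at x within sphere 0 1)"
  shows "D v = E v"
proof -
  define c where "c t = cos t *\<^sub>R x + sin t *\<^sub>R v" for t :: real
  have "norm (c t) = 1" for t
  proof -
    have "(norm (c t))\<^sup>2 = (cos t)\<^sup>2 + (sin t)\<^sup>2"
      using x v unfolding power2_norm_eq_inner norm_eq_1
      by (simp add: c_def inner_add_left inner_add_right inner_commute[of x v] power2_eq_square)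
    then have "(norm (c t))\<^sup>2 = 1" by simp
    then show ?thesis using norm_ge_zero[of "c t"] unfolding power2_eq_1_iff by linarith
  qed
  then have sub: "c ` UNIV \<subseteq> sphere 0 1" by auto
  have c0: "c 0 = x" by (simp add: c_def)
  have c': "(c has_derivative (\<lambda>t. t *\<^sub>R v)) (at 0)"
    unfolding c_def[abs_def] by (auto intro!: derivative_eq_intros)
  have "((\<lambda>t. g (c t)) has_derivative (\<lambda>t. F (t *\<^sub>R v))) (at 0)"
    if "(g has_derivative F) (at x within sphere 0 1)" for F
    using has_derivative_in_compose[OF c', of g F] has_derivative_subset[OF that sub] by (simp add: c0)
  from has_derivative_unique[OF this[OF D] this[OF E]]
  have "(\<lambda>t::real. D (t *\<^sub>R v)) = (\<lambda>t. E (t *\<^sub>R v))" .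
  from fun_cong[OF this, of 1] show ?thesis by simp
qed

text \<open>
  The sphere must have positive dimension: only a nonzero tangent vector can determine the factor.
\<close>
lemma conformal_factor_eqI:
  fixes g :: "'a::euclidean_space \<Rightarrow> 'a"
  assumes dim: "2 \<le> DIM('a)" and x: "norm x = 1" and c: "0 < c"
    and D: "(g has_derivative D) (at x within sphere 0 1)"
    and conf: "\<And>v w. v \<bullet> x = 0 \<Longrightarrow> w \<bullet> x = 0 \<Longrightarrow> D v \<bullet> D w = c\<^sup>2 * (v \<bullet> w)"
  shows "conformal_factor g x = c"
  unfolding conformal_factor_def
proof (rule the_equality, safe)
  show "0 < c" by fact
  show "\<exists>D. (g has_derivative D) (at x within sphere 0 1) \<and>
             (\<forall>v w. v \<bullet> x = 0 \<longrightarrow> w \<bullet> x = 0 \<longrightarrow> (D v /\<^sub>R c) \<bullet> (D w /\<^sub>R c) = v \<bullet> w)"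
    using c by (intro exI[of _ D] conjI D) (auto simp: conf power2_eq_square field_simps)
next
  fix e E assume e: "0 < e" and E: "(g has_derivative E) (at x within sphere 0 1)"
    and Ec: "\<forall>v w. v \<bullet> x = 0 \<longrightarrow> w \<bullet> x = 0 \<longrightarrow> (E v /\<^sub>R e) \<bullet> (E w /\<^sub>R e) = v \<bullet> w"
  obtain v0 where v0: "v0 \<noteq> 0" "orthogonal x v0"
    using orthogonal_to_vector_exists[OF dim, of x] by metis
  define v where "v = sgn v0"
  have v: "norm v = 1" "v \<bullet> x = 0"
    using v0 by (auto simp: v_def norm_sgn sgn_div_norm orthogonal_def inner_commute)
  have "D v = E v" by (rule has_derivative_within_sphere_unique[OF x v D E])
  moreover have "E v \<bullet> E v = e\<^sup>2"
    using Ec[rule_format, of v v] v e by (simp add: power2_eq_square field_simps norm_eq_1)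
  ultimately have "e\<^sup>2 = c\<^sup>2"
    using conf[of v v] v by (simp add: norm_eq_1)
  then show "e = c" using e c by (simp add: power2_eq_iff_nonneg)
qed

text \<open>
  On tangent vectors the radial part of the Gram identity vanishes.
\<close>
lemma conformal_factor_lorentz_action:
  fixes A :: "real ^ ('m::finite option) ^ ('m option)"
  assumes A: "A \<in> SO_plus" and x: "norm x = 1" and dim: "2 \<le> CARD('m)"
  shows "conformal_factor (lorentz_action A) x = 1 / cone_time A x"
proof (rule conformal_factor_eqI)
  have x0: "x \<noteq> 0" using x by auto
  have sg: "sgn x = x" using x by (simp add: sgn_div_norm)
  show "2 \<le> DIM(real ^ 'm)" using dim by simp
  show "norm x = 1" by fact
  show "0 < 1 / cone_time A x" using cone_time_pos[OF A x0] by simp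
  have "(cone_map A has_derivative cone_map_derivative A x) (at x within sphere 0 1)"
    using has_derivative_cone_map[OF A x0] by (rule has_derivative_at_withinI)
  then show "(lorentz_action A has_derivative cone_map_derivative A x) (at x within sphere 0 1)"
    by (rule has_derivative_transform[rotated 2]) (use x in \<open>auto simp: lorentz_action_sphere[OF A]\<close>)
  show "cone_map_derivative A x v \<bullet> cone_map_derivative A x w = (1 / cone_time A x)\<^sup>2 * (v \<bullet> w)"
    if "v \<bullet> x = 0" "w \<bullet> x = 0" for v w
    using that by (simp add: cone_map_derivative_gram[OF A x0] sg x inner_commute)
qed

section \<open>Lipschitz functions and the form domain\<close>

lemma (in finite_measure) L2_space_integrable:
  assumes "f \<in> L2_space M"
  shows "integrable M f"
proof -
  have "(\<lambda>x. 1) \<in> L2_space M" by (simp add: L2_space_def)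
  from L2_space_integrable_mult[OF assms this] show ?thesis by simp
qed

text \<open>
  The test functions decrease to the indicator of the closed set \<open>F\<close>, so \<open>f\<close> integrates to zero over
  closed sets; these form an intersection-stable generator of the Borel sets.
\<close>
lemma L2_zero_if_orthogonal_to_lipschitz:
  fixes f :: "'a::metric_space \<Rightarrow> real"
  assumes "finite_measure M"
    and sets: "sets M = sets (restrict_space borel S)"
    and f: "f \<in> L2_space M"
    and orth: "\<And>F k. closed F \<Longrightarrow> F \<noteq> {} \<Longrightarrow> L2_inner M f (\<lambda>x. max 0 (1 - real k * infdist x F)) = 0"
  shows "AE x in M. f x = 0"
proof -
  interpret finite_measure M by fact
  have id[measurable]: "(\<lambda>x. x) \<in> M \<rightarrow>\<^sub>M borel"
    unfolding measurable_cong_sets[OF sets refl] by (rule measurable_restrict_space1) simp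
  have int: "integrable M f" using f by (rule L2_space_integrable)
  have [measurable]: "f \<in> borel_measurable M" using int by simp
  have meas: "B \<inter> space M \<in> sets M" if "B \<in> sets borel" for B :: "'a set"
    using measurable_sets[OF id that] by simp
  define J where "J B = (LINT x:B \<inter> space M|M. f x)" for B
  have intB: "set_integrable M (B \<inter> space M) f" if "B \<in> sets borel" for B
    unfolding set_integrable_def using meas[OF that] int by (intro integrable_mult_indicator)
  have closed: "J F = 0" if F: "closed F" for F :: "'a set"
  proof (cases "F = {}")
    case False
    let ?g = "\<lambda>k x. max 0 (1 - real k * infdist x F)"
    have "(\<lambda>k. LINT x|M. f x * ?g k x) \<longlonglongrightarrow> (LINT x|M. indicator (F \<inter> space M) x *\<^sub>R f x)"
    proof (rule integral_dominated_convergence[where w = "\<lambda>x. \<bar>f x\<bar>"])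
      show "(\<lambda>x. indicator (F \<inter> space M) x *\<^sub>R f x) \<in> borel_measurable M"
        using meas[of F] F by measurable
      show "(\<lambda>x. f x * ?g k x) \<in> borel_measurable M" for k
      proof -
        have "(\<lambda>x. infdist x F) \<in> borel_measurable M"
          using borel_measurable_continuous_onI[OF continuous_on_infdist[OF continuous_on_id], of F]
          by (rule measurable_compose[OF id])
        then show ?thesis by measurable
      qed
      show "integrable M (\<lambda>x. \<bar>f x\<bar>)" using int by simp
      show "AE x in M. (\<lambda>k. f x * ?g k x) \<longlonglongrightarrow> indicator (F \<inter> space M) x *\<^sub>R f x"
      proof (rule AE_I2)
        fix x assume x: "x \<in> space M"
        show "(\<lambda>k. f x * ?g k x) \<longlonglongrightarrow> indicator (F \<inter> space M) x *\<^sub>R f x"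
        proof (cases "x \<in> F")
          case True
          then show ?thesis using x by simp
        next
          case False
          then have pos: "infdist x F > 0"
            using infdist_nonneg[of x F] in_closed_iff_infdist_zero[OF F \<open>F \<noteq> {}\<close>, of x] by linarith
          obtain N :: nat where N: "1 < real N * infdist x F"
            using reals_Archimedean3[OF pos, rule_format, of 1] by auto
          have "f x * ?g k x = 0" if "k \<ge> N" for k
          proof -
            have "real N * infdist x F \<le> real k * infdist x F"
              using that pos by (intro mult_right_mono) auto
            then show ?thesis using N by simp
          qed
          then have "\<forall>\<^sub>F k in sequentially. f x * ?g k x = 0"
            unfolding eventually_sequentially by blast
          then have "(\<lambda>k. f x * ?g k x) \<longlonglongrightarrow> 0" by (rule tendsto_eventually)
          then show ?thesis using False by simp
        qed
      qed
      show "AE x in M. norm (f x * ?g k x) \<le> \<bar>f x\<bar>" for k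
      proof (rule AE_I2)
        fix x
        have "\<bar>?g k x\<bar> \<le> 1" using infdist_nonneg[of x F] by (simp add: abs_if)
        then show "norm (f x * ?g k x) \<le> \<bar>f x\<bar>"
          using mult_left_mono[of "\<bar>?g k x\<bar>" 1 "\<bar>f x\<bar>"] by (simp add: abs_mult)
      qed
    qed
    moreover have "(LINT x|M. f x * ?g k x) = 0" for k
      using orth[OF F False, of k] by (simp add: L2_inner_def)
    ultimately show ?thesis
      by (simp add: J_def set_lebesgue_integral_def LIMSEQ_const_iff)
  qed (simp add: J_def set_lebesgue_integral_def)
  have J_zero: "J B = 0" if "B \<in> sets borel" for B
  proof -
    have "Int_stable {F :: 'a set. closed F}" "{F :: 'a set. closed F} \<subseteq> Pow UNIV"
      "B \<in> sigma_sets UNIV {F. closed F}"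
      using that by (auto simp: Int_stable_def borel_eq_closed)
    then show ?thesis
    proof (induction rule: sigma_sets_induct_disjoint)
      case (basic A)
      then show ?case by (simp add: closed)
    next
      case empty
      then show ?case by (simp add: J_def set_lebesgue_integral_def)
    next
      case (compl A)
      then have A: "A \<in> sets borel" by (simp add: borel_eq_closed)
      have "J UNIV = J (A \<union> (UNIV - A))" by simp
      also have "\<dots> = J A + J (UNIV - A)"
        unfolding J_def Int_Un_distrib2
        by (rule set_integral_Un[OF _ intB intB]) (use A in auto)
      finally show ?case using compl closed[of UNIV] by simp
    next
      case (union A)
      then have A: "A i \<in> sets borel" for i by (auto simp: borel_eq_closed)
      have "J (\<Union>i. A i) = (LINT x:(\<Union>i. A i \<inter> space M)|M. f x)"
        by (simp add: J_def)
      also have "\<dots> = (\<Sum>i. (LINT x:(A i \<inter> space M)|M. f x))"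
      proof (rule lebesgue_integral_countable_add)
        show "A i \<inter> space M \<in> sets M" for i by (rule meas[OF A])
        show "(A i \<inter> space M) \<inter> (A j \<inter> space M) = {}" if "i \<noteq> j" for i j
          using union(1) that by (auto simp: disjoint_family_on_def)
        show "set_integrable M (\<Union>i. A i \<inter> space M) f"
          using intB[of "\<Union>i. A i"] A by simp
      qed
      also have "\<dots> = 0" using union(3) by (simp add: J_def)
      finally show ?case .
    qed
  qed
  have "AE x in M. f x = (\<lambda>x. 0) x"
  proof (rule density_unique_real[OF int])
    fix A assume "A \<in> sets M"
    then obtain B where B: "B \<in> sets borel" "A = S \<inter> B" by (auto simp: sets sets_restrict_space)
    have "space M = S"
      using sets_eq_imp_space_eq[OF sets] by (simp add: space_restrict_space)
    then show "(LINT x:A|M. f x) = (LINT x:A|M. 0)"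
      using J_zero[OF B(1)] B(2) by (simp add: J_def Int_commute set_lebesgue_integral_def)
  qed simp
  then show ?thesis by simp
qed

text \<open>
  One of the two factors \<open>dist x y\<close> gained from the Lipschitz bound is spent on the kernel, the other
  is bounded by the diameter.
\<close>
lemma lipschitz_in_log_form_dom:
  fixes g :: "'a::metric_space \<Rightarrow> real"
  assumes "finite_measure M" and [measurable]: "g \<in> borel_measurable M"
    and bound: "\<And>x. x \<in> space M \<Longrightarrow> \<bar>g x\<bar> \<le> B"
    and lip: "\<And>x y. x \<in> space M \<Longrightarrow> y \<in> space M \<Longrightarrow> \<bar>g x - g y\<bar> \<le> L * dist x y"
    and diam: "\<And>x y. x \<in> space M \<Longrightarrow> y \<in> space M \<Longrightarrow> dist x y \<le> D"
    and kernel: "\<And>x. x \<in> space M \<Longrightarrow> (\<integral>\<^sup>+y. ennreal (dist x y / dist x y ^ n) \<partial>M) \<le> ennreal c"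
    and [measurable]: "(\<lambda>(x, y). dist x y) \<in> borel_measurable (M \<Otimes>\<^sub>M M)"
  shows "g \<in> log_form_dom n dist M"
proof -
  interpret finite_measure M by fact
  have "integrable M (\<lambda>x. (g x)\<^sup>2)"
  proof (rule integrable_const_bound[where B = "B\<^sup>2"])
    have "(g x)\<^sup>2 \<le> B\<^sup>2" if "x \<in> space M" for x
      using power_mono[OF bound[OF that], of 2] by simp
    then show "AE x in M. norm ((g x)\<^sup>2) \<le> B\<^sup>2" by simp
  qed measurable
  then have L2: "g \<in> L2_space M" by (simp add: L2_space_def)
  have le: "\<bar>g x - g y\<bar>\<^sup>2 / dist x y ^ n \<le> L\<^sup>2 * \<bar>D\<bar> * (dist x y / dist x y ^ n)"
    if "x \<in> space M" "y \<in> space M" for x y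
  proof -
    have "\<bar>g x - g y\<bar>\<^sup>2 \<le> (L * dist x y)\<^sup>2"
      using lip[OF that] by (intro power_mono) auto
    also have "\<dots> = L\<^sup>2 * dist x y * dist x y" by (simp add: power2_eq_square)
    also have "\<dots> \<le> L\<^sup>2 * \<bar>D\<bar> * dist x y"
      using diam[OF that] by (intro mult_right_mono mult_left_mono) auto
    finally show ?thesis
      using divide_right_mono[of "\<bar>g x - g y\<bar>\<^sup>2" "L\<^sup>2 * \<bar>D\<bar> * dist x y" "dist x y ^ n"] by simp
  qed
  have "(\<integral>\<^sup>+x. (\<integral>\<^sup>+y. ennreal (\<bar>g x - g y\<bar>\<^sup>2 / dist x y ^ n) \<partial>M) \<partial>M)
      \<le> (\<integral>\<^sup>+x. (\<integral>\<^sup>+y. ennreal (L\<^sup>2 * \<bar>D\<bar>) * ennreal (dist x y / dist x y ^ n) \<partial>M) \<partial>M)"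
  proof (intro nn_integral_mono)
    fix x y assume "x \<in> space M" "y \<in> space M"
    from ennreal_leI[OF le[OF this]]
    show "ennreal (\<bar>g x - g y\<bar>\<^sup>2 / dist x y ^ n) \<le> ennreal (L\<^sup>2 * \<bar>D\<bar>) * ennreal (dist x y / dist x y ^ n)"
      by (subst ennreal_mult[symmetric]) auto
  qed
  also have "\<dots> = (\<integral>\<^sup>+x. ennreal (L\<^sup>2 * \<bar>D\<bar>) * (\<integral>\<^sup>+y. ennreal (dist x y / dist x y ^ n) \<partial>M) \<partial>M)"
    by (intro nn_integral_cong nn_integral_cmult) measurable
  also have "\<dots> \<le> (\<integral>\<^sup>+x. ennreal (L\<^sup>2 * \<bar>D\<bar>) * ennreal c \<partial>M)"
    by (intro nn_integral_mono mult_left_mono kernel) auto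
  also have "\<dots> < \<infinity>"
    by (simp add: ennreal_mult_less_top less_top[symmetric] ennreal_mult_eq_top_iff)
  finally show ?thesis using L2 by (simp add: log_form_dom_def)
qed

section \<open>The volume measure of the round sphere\<close>

lemma space_sphere_measure: "space (sphere_measure :: 'a::euclidean_space measure) = sphere 0 1"
  by (simp add: sphere_measure_def space_scale_measure space_restrict_space)

lemma sets_sphere_measure:
  "sets (sphere_measure :: 'a::euclidean_space measure) = sets (restrict_space borel (sphere 0 1))"
  by (simp add: sphere_measure_def)

lemma measurable_sphere_measureI:
  assumes "f \<in> measurable borel N"
  shows "f \<in> measurable (sphere_measure :: 'a::euclidean_space measure) N"
  unfolding measurable_cong_sets[OF sets_sphere_measure refl] using assms
  by (rule measurable_restrict_space1)

lemma sets_sphere_measureD: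
  assumes "B \<in> sets (sphere_measure :: 'a::euclidean_space measure)"
  shows "B \<in> sets borel" "B \<subseteq> sphere 0 1"
  using assms unfolding sets_sphere_measure by (auto simp: sets_restrict_space)

lemma measurable_sgn_euclidean: "(sgn :: 'a::euclidean_space \<Rightarrow> 'a) \<in> borel_measurable borel"
  unfolding sgn_div_norm[abs_def] by measurable

lemma measurable_sgn_ball:
  "sgn \<in> restrict_space lborel (ball 0 1 - {0}) \<rightarrow>\<^sub>M restrict_space borel (sphere (0 :: 'a::euclidean_space) 1)"
  by (rule measurable_restrict_space3)
    (use measurable_sgn_euclidean in \<open>auto simp: norm_sgn measurable_lborel1\<close>)

lemma nn_integral_sphere_measure:
  fixes \<phi> :: "'a::euclidean_space \<Rightarrow> ennreal"
  assumes \<phi>: "\<phi> \<in> borel_measurable sphere_measure"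
  shows "(\<integral>\<^sup>+x. \<phi> x \<partial>sphere_measure) =
    of_nat DIM('a) * (\<integral>\<^sup>+x\<in>ball 0 1 - {0}. \<phi> (sgn x) \<partial>lborel)"
proof -
  have \<phi>': "\<phi> \<in> borel_measurable (restrict_space borel (sphere 0 1))"
    using \<phi> unfolding measurable_cong_sets[OF sets_sphere_measure refl] .
  have "(\<integral>\<^sup>+x. \<phi> x \<partial>sphere_measure) = of_nat DIM('a) * (\<integral>\<^sup>+x. \<phi> x
     \<partial>distr (restrict_space lborel (ball 0 1 - {0})) (restrict_space borel (sphere 0 1)) sgn)"
    unfolding sphere_measure_def using \<phi>' by (subst nn_integral_scale_measure) auto
  also have "\<dots> = of_nat DIM('a) * (\<integral>\<^sup>+x. \<phi> (sgn x) \<partial>restrict_space lborel (ball 0 1 - {0}))"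
    using \<phi>' by (subst nn_integral_distr[OF measurable_sgn_ball]) simp_all
  finally show ?thesis
    by (subst (asm) nn_integral_restrict_space) auto
qed

definition sphere_cone :: "'a::euclidean_space set \<Rightarrow> 'a set" where
  "sphere_cone B = {x \<in> ball 0 1 - {0}. sgn x \<in> B}"

lemma sphere_cone_borel: "B \<in> sets borel \<Longrightarrow> sphere_cone B \<in> sets borel"
  using measurable_sets[OF measurable_sgn_euclidean, of B]
  by (auto simp: sphere_cone_def vimage_def Collect_conj_eq[of _ "\<lambda>x. sgn x \<in> B"] intro!: sets.Int)

lemma emeasure_sphere_measure:
  fixes B :: "'a::euclidean_space set"
  assumes B: "B \<in> sets sphere_measure"
  shows "emeasure sphere_measure B = of_nat DIM('a) * emeasure lborel (sphere_cone B)"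
proof -
  have "emeasure sphere_measure B = (\<integral>\<^sup>+x. indicator B x \<partial>sphere_measure)"
    using B by simp
  also have "\<dots> = of_nat DIM('a) * (\<integral>\<^sup>+x\<in>ball 0 1 - {0}. indicator B (sgn x) \<partial>lborel)"
    using B by (intro nn_integral_sphere_measure) simp
  also have "(\<integral>\<^sup>+x\<in>ball 0 1 - {0}. indicator B (sgn x) \<partial>lborel) = (\<integral>\<^sup>+x. indicator (sphere_cone B) x \<partial>lborel)"
    by (intro nn_integral_cong) (auto simp: sphere_cone_def indicator_def)
  also have "\<dots> = emeasure lborel (sphere_cone B)"
    using sphere_cone_borel[OF sets_sphere_measureD(1)[OF B]] by simp
  finally show ?thesis .
qed

lemma finite_measure_sphere_measure: "finite_measure (sphere_measure :: 'a::euclidean_space measure)"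
proof
  have "emeasure lborel (sphere_cone (sphere 0 1) :: 'a set) < \<infinity>"
    by (rule emeasure_bounded_finite, rule bounded_subset[OF bounded_ball[of 0 1]])
      (auto simp: sphere_cone_def)
  moreover have "sphere 0 1 \<in> sets (sphere_measure :: 'a measure)"
    using sets.top[of "sphere_measure :: 'a measure"] by (simp add: space_sphere_measure)
  ultimately show "emeasure sphere_measure (space (sphere_measure :: 'a measure)) \<noteq> \<infinity>"
    by (simp add: space_sphere_measure emeasure_sphere_measure ennreal_mult_eq_top_iff less_top)
qed

lemma measurable_dist_sphere_measure:
  "(\<lambda>(x, y). dist x y) \<in>
     borel_measurable (sphere_measure \<Otimes>\<^sub>M (sphere_measure :: 'a::euclidean_space measure))"
proof -
  have [measurable]: "(\<lambda>x. x) \<in> borel_measurable (sphere_measure :: 'a measure)"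
    by (rule measurable_sphere_measureI) simp
  show ?thesis unfolding split_def by measurable
qed

text \<open>
  The cone over a cap of radius \<open>r\<close> around \<open>x\<close> lies within distance \<open>r\<close> of the segment from \<open>0\<close> to
  \<open>x\<close>, and that tube is covered by about \<open>1 / r\<close> balls of radius \<open>2 r\<close>: one power of \<open>r\<close>
  fewer than the volume of a ball.
\<close>
lemma emeasure_spherical_cap_le:
  obtains c where "0 < c" "\<And>(x :: 'a::euclidean_space) r. norm x = 1 \<Longrightarrow> 0 < r \<Longrightarrow> r \<le> 2 \<Longrightarrow>
     emeasure sphere_measure (sphere 0 1 \<inter> cball x r) \<le> ennreal (c * r ^ (DIM('a) - 1))"
proof
  let ?\<omega> = "unit_ball_vol (DIM('a))" and ?N = "DIM('a)"
  let ?c = "?N * (3 * ?\<omega> * 2 ^ ?N)"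
  show "0 < ?c" by simp
  fix x :: 'a and r :: real assume x: "norm x = 1" and r: "0 < r" "r \<le> 2"
  define m where "m = nat \<lceil>1 / r\<rceil>"
  have m: "1 / r \<le> m" "m \<le> 3 / r"
  proof -
    show "1 / r \<le> m" unfolding m_def by (rule real_nat_ceiling_ge)
    have "real m < 1 / r + 1" unfolding m_def using r by (simp add: of_nat_ceiling)  linarith
    also have "\<dots> \<le> 3 / r" using r by (simp add: field_simps)
    finally show "m \<le> 3 / r" by simp
  qed
  have m0: "m > 0" using m(1) r by (cases m) (auto simp: divide_le_0_iff)
  let ?B = "\<lambda>j. ball ((real j / m) *\<^sub>R x) (2 * r)"
  have sub: "sphere_cone (sphere 0 1 \<inter> cball x r) \<subseteq> (\<Union>j<m. ?B j)"
  proof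
    fix z assume "z \<in> sphere_cone (sphere 0 1 \<inter> cball x r)"
    then have z: "norm z < 1" "z \<noteq> 0" "dist x (sgn z) \<le> r" by (auto simp: sphere_cone_def)
    define s where "s = norm z"
    have s: "0 < s" "s < 1" using z by (auto simp: s_def)
    \<comment> \<open>the ball with the last centre before the foot \<open>s x\<close> on the segment\<close>
    define j where "j = nat \<lfloor>s * m\<rfloor>"
    have j: "real j \<le> s * m" "s * m < real j + 1"
      using s m0 by (auto simp: j_def)
    have "real j < m" using j(1) s m0 by (smt (verit) mult_less_cancel_right2 of_nat_0_less_iff)
    have 1: "\<bar>s - j / m\<bar> \<le> r"
    proof -
      have "\<bar>s - j / m\<bar> \<le> 1 / m"
      proof -
        have "s - j / m = (s * m - j) / m" using m0 by (simp add: field_simps)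
        then have "\<bar>s - j / m\<bar> = (s * m - j) / m" using j m0 by simp
        then show ?thesis using j m0 by (simp add: divide_right_mono)
      qed
      also have "1 / m \<le> r" using m(1) m0 r by (simp add: field_simps)
      finally show ?thesis .
    qed
    have "z = s *\<^sub>R sgn z" using z by (simp add: s_def sgn_div_norm)
    then have "norm (z - s *\<^sub>R x) = s * dist x (sgn z)"
      using s by (metis dist_commute dist_norm norm_scaleR abs_of_pos real_vector.scale_right_diff_distrib)
    also have "\<dots> < r" using s z(3) r by (smt (verit) mult_less_cancel_right2 zero_le_dist mult_le_cancel_right2)
    finally have 2: "norm (z - s *\<^sub>R x) < r" .
    have "dist ((real j / m) *\<^sub>R x) z \<le> norm (z - s *\<^sub>R x) + norm (s *\<^sub>R x - (j / m) *\<^sub>R x)"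
      using norm_triangle_ineq[of "z - s *\<^sub>R x" "s *\<^sub>R x - (j / m) *\<^sub>R x"] by (simp add: dist_norm norm_minus_commute)
    also have "norm (s *\<^sub>R x - (j / m) *\<^sub>R x) = \<bar>s - j / m\<bar>"
      using x by (simp flip: scaleR_left_diff_distrib)
    finally have "z \<in> ?B j" using 1 2 by simp
    then show "z \<in> (\<Union>j<m. ?B j)" using \<open>real j < m\<close> by auto
  qed
  have "emeasure lborel (sphere_cone (sphere 0 1 \<inter> cball x r)) \<le> emeasure lborel (\<Union>j<m. ?B j)"
    by (rule emeasure_mono[OF sub]) auto
  also have "\<dots> \<le> (\<Sum>j<m. emeasure lborel (?B j))"
    by (rule emeasure_subadditive_finite) auto
  also have "\<dots> = (\<Sum>j<m. ennreal (?\<omega> * (2 * r) ^ ?N))"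
    using r by (intro sum.cong refl emeasure_ball) simp
  also have "\<dots> = ennreal (m * (?\<omega> * (2 * r) ^ ?N))"
    using r by (simp add: ennreal_of_nat_eq_real_of_nat ennreal_mult)
  also have "\<dots> \<le> ennreal (3 / r * (?\<omega> * (2 * r) ^ ?N))"
    using r m by (intro ennreal_leI mult_right_mono) auto
  also have "3 / r * (?\<omega> * (2 * r) ^ ?N) = 3 * ?\<omega> * 2 ^ ?N * r ^ (?N - 1)"
  proof -
    have "r ^ ?N = r * r ^ (?N - 1)" by (simp add: power_eq_if)
    then show ?thesis using r by (simp add: power_mult_distrib)
  qed
  finally have "emeasure lborel (sphere_cone (sphere 0 1 \<inter> cball x r)) \<le> ennreal (3 * ?\<omega> * 2 ^ ?N * r ^ (?N - 1))" .
  then have "of_nat ?N * emeasure lborel (sphere_cone (sphere 0 1 \<inter> cball x r)) \<le>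
      ennreal ?N * ennreal (3 * ?\<omega> * 2 ^ ?N * r ^ (?N - 1))"
    by (auto simp: ennreal_of_nat_eq_real_of_nat intro: mult_left_mono)
  moreover have "sphere 0 1 \<inter> cball x r \<in> sets sphere_measure"
    unfolding sets_sphere_measure by (auto simp: sets_restrict_space)
  ultimately show "emeasure sphere_measure (sphere 0 1 \<inter> cball x r) \<le> ennreal (?c * r ^ (?N - 1))"
    using r by (simp add: emeasure_sphere_measure mult.assoc flip: ennreal_mult)
qed

text \<open>
  The quotient is \<open>dist\<^bsup>1-n\<^esup>\<close> off the diagonal and \<open>0\<close> on it; for \<open>n = 0\<close> it is the
  bounded function \<open>dist\<close>.  On the shell where the distance is comparable to \<open>2\<^bsup>-k\<^esup>\<close> the integrand is
  of order \<open>2\<^bsup>k(n-1)\<^esup>\<close> and the volume of order \<open>2\<^bsup>-kn\<^esup>\<close>, so the shells contribute a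
  geometric series.
\<close>
lemma sphere_kernel_bound:
  assumes n: "DIM('a::euclidean_space) = Suc n"
  obtains c where "0 < c" "\<And>x::'a. norm x = 1 \<Longrightarrow>
     (\<integral>\<^sup>+y. ennreal (dist x y / dist x y ^ n) \<partial>sphere_measure) \<le> ennreal c"
proof (cases "n = 0")
  case True
  interpret finite_measure "sphere_measure :: 'a measure" by (rule finite_measure_sphere_measure)
  let ?m = "measure (sphere_measure :: 'a measure) (space sphere_measure)"
  show ?thesis
  proof (rule that[of "2 * ?m + 1"])
    fix x :: 'a assume x: "norm x = 1"
    have "(\<integral>\<^sup>+y. ennreal (dist x y / dist x y ^ n) \<partial>sphere_measure) \<le> (\<integral>\<^sup>+(y::'a). ennreal 2 \<partial>sphere_measure)"
    proof (intro nn_integral_mono ennreal_leI)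
      fix y :: 'a assume "y \<in> space sphere_measure"
      then show "dist x y / dist x y ^ n \<le> 2"
        using True x norm_triangle_ineq4[of x y] by (simp add: space_sphere_measure dist_norm)
    qed
    also have "\<dots> \<le> ennreal (2 * ?m + 1)"
      by (simp add: emeasure_eq_measure flip: ennreal_mult) (simp add: ennreal_leI flip: ennreal_numeral ennreal_mult)
    finally show "(\<integral>\<^sup>+y. ennreal (dist x y / dist x y ^ n) \<partial>sphere_measure) \<le> ennreal (2 * ?m + 1)" .
  qed (simp add: add_nonneg_pos)
next
  case False
  obtain c where c: "0 < c" and cap: "\<And>(x :: 'a) r. norm x = 1 \<Longrightarrow> 0 < r \<Longrightarrow> r \<le> 2 \<Longrightarrow>
     emeasure sphere_measure (sphere 0 1 \<inter> cball x r) \<le> ennreal (c * r ^ n)"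
    using emeasure_spherical_cap_le[where 'a='a] n by (metis diff_Suc_1)
  \<comment> \<open>dyadic radii, starting from the diameter\<close>
  define r :: "nat \<Rightarrow> real" where "r k = 2 * (1 / 2) ^ k" for k
  have r: "0 < r k" "r k \<le> 2" "r (Suc k) = r k / 2" for k
    by (auto simp: r_def power_le_one)
  have sums: "r sums 4"
    using sums_mult[OF geometric_sums[of "1 / 2 :: real"], of 2] by (simp add: r_def[abs_def])
  \<comment> \<open>the size of the integrand at distance \<open>r (Suc k) = r k / 2\<close>\<close>
  define w where "w k = (2 / r k) ^ (n - 1)" for k
  have wpos: "w k > 0" for k using r[of k] by (simp add: w_def)
  show ?thesis
  proof (rule that)
    show "0 < c * 2 ^ (n - 1) * 4" using c by simp
    fix x :: 'a assume x: "norm x = 1"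
    let ?C = "\<lambda>k. sphere 0 1 \<inter> cball x (r k)"
    have C[measurable]: "?C k \<in> sets sphere_measure" for k
      unfolding sets_sphere_measure by (auto simp: sets_restrict_space)
    have "(\<integral>\<^sup>+y. ennreal (dist x y / dist x y ^ n) \<partial>sphere_measure) \<le>
       (\<integral>\<^sup>+y. (\<Sum>k. ennreal (w k) * indicator (?C k) y) \<partial>sphere_measure)"
    proof (rule nn_integral_mono)
      fix y :: 'a assume "y \<in> space sphere_measure"
      then have y: "norm y = 1" by (simp add: space_sphere_measure)
      show "ennreal (dist x y / dist x y ^ n) \<le> (\<Sum>k. ennreal (w k) * indicator (?C k) y)"
      proof (cases "y = x")
        case False
        then have d: "0 < dist x y" by simp
        have d2: "dist x y \<le> 2" using x y norm_triangle_ineq4[of x y] by (simp add: dist_norm)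
        have "\<exists>K. r K < dist x y"
          using real_arch_pow_inv[of "dist x y / 2" "1 / 2"] d by (auto simp: r_def field_simps)
        define K where "K = (LEAST K. r K < dist x y)"
        have K: "r K < dist x y"
          using \<open>\<exists>K. r K < dist x y\<close> unfolding K_def by (rule LeastI_ex)
        have "K \<noteq> 0"
        proof
          assume "K = 0"
          then show False using K d2 by (simp add: r_def)
        qed
        then obtain k where k: "K = Suc k" by (cases K) auto
        have "\<not> r k < dist x y" using not_less_Least[of k "\<lambda>K. r K < dist x y"] k by (simp add: K_def)
        then have yC: "y \<in> ?C k" using y by simp
        have "dist x y / dist x y ^ n = 1 / dist x y ^ (n - 1)"
          using d \<open>n \<noteq> 0\<close> by (simp add: power_eq_if)
        also have "\<dots> \<le> 1 / (r k / 2) ^ (n - 1)"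
          using K r[of k] k d by (intro divide_left_mono power_mono) auto
        also have "\<dots> = w k" by (simp add: w_def power_divide)
        finally have "ennreal (dist x y / dist x y ^ n) \<le> ennreal (w k) * indicator (?C k) y"
          using yC by (simp add: ennreal_leI)
        also have "\<dots> \<le> (\<Sum>k. ennreal (w k) * indicator (?C k) y)"
        proof -
          have "t k \<le> (\<Sum>k. t k)" for t :: "nat \<Rightarrow> ennreal"
            using sum_le_suminf[of t "{k}"] by simp
          then show ?thesis .
        qed
        finally show ?thesis .
      qed (simp add: \<open>n \<noteq> 0\<close>)
    qed
    also have "\<dots> = (\<Sum>k. \<integral>\<^sup>+y. ennreal (w k) * indicator (?C k) y \<partial>sphere_measure)"
      by (rule nn_integral_suminf) measurable
    also have "\<dots> = (\<Sum>k. ennreal (w k) * emeasure sphere_measure (?C k))"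
      by (simp add: nn_integral_cmult_indicator)
    also have "\<dots> \<le> (\<Sum>k. ennreal (c * 2 ^ (n - 1) * r k))"
    proof (intro suminf_le)
      fix k
      have "ennreal (w k) * emeasure sphere_measure (?C k) \<le> ennreal (w k) * ennreal (c * r k ^ n)"
        using r x by (intro mult_left_mono cap) auto
      also have "\<dots> = ennreal (w k * (c * r k ^ n))"
        using wpos[of k] c r[of k] by (intro ennreal_mult[symmetric]) auto
      also have "w k * (c * r k ^ n) = c * 2 ^ (n - 1) * r k"
      proof -
        have "r k ^ n = r k * r k ^ (n - 1)" using \<open>n \<noteq> 0\<close> by (simp add: power_eq_if)
        then show ?thesis using r(1)[of k] by (simp add: w_def power_divide)
      qed
      finally show "ennreal (w k) * emeasure sphere_measure (?C k) \<le> ennreal (c * 2 ^ (n - 1) * r k)" .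
    qed auto
    also have "\<dots> = ennreal (\<Sum>k. c * 2 ^ (n - 1) * r k)"
      using c r sums_summable[OF sums] by (intro suminf_ennreal2) (auto intro: less_imp_le)
    also have "(\<Sum>k. c * 2 ^ (n - 1) * r k) = c * 2 ^ (n - 1) * 4"
      using sums_mult[OF sums] by (rule sums_unique[symmetric])
    finally show "(\<integral>\<^sup>+y. ennreal (dist x y / dist x y ^ n) \<partial>sphere_measure) \<le> ennreal (c * 2 ^ (n - 1) * 4)" .
  qed
qed

section \<open>The Lorentz action on the round sphere\<close>

lemma continuous_on_light_vec: "continuous_on UNIV light_vec"
  using continuous_on_compose[of UNIV "\<lambda>x. (x, norm x)" "\<lambda>(x, t). event x t"]
    linear_continuous_on[OF bounded_linear_event, of "(\<lambda>x. (x, norm x)) ` UNIV"]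
  by (simp add: o_def light_vec_def[abs_def] continuous_on_Pair continuous_on_norm continuous_on_id)

lemma measurable_cone_time[measurable]: "cone_time A \<in> borel_measurable borel"
  and measurable_cone_space[measurable]: "cone_space A \<in> borel_measurable borel"
proof -
  have c: "continuous_on UNIV (\<lambda>x. A *v light_vec x)"
    using continuous_on_compose[OF continuous_on_light_vec, of "\<lambda>v. A *v v"]
      linear_continuous_on[OF matrix_vector_mul_bounded_linear[of A]]
    by (auto simp: o_def intro: continuous_on_subset)
  have "continuous_on UNIV (\<lambda>x. (A *v light_vec x) $ None)"
    using c by (intro continuous_intros)
  then show "cone_time A \<in> borel_measurable borel"
    unfolding cone_time_def[abs_def] by (rule borel_measurable_continuous_onI)
  have "continuous_on UNIV (\<lambda>x. space_part (A *v light_vec x))"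
    using continuous_on_compose[OF c, of space_part]
      linear_continuous_on[OF bounded_linear_space_part]
    by (auto simp: o_def)
  then show "cone_space A \<in> borel_measurable borel"
    unfolding cone_space_def[abs_def] by (rule borel_measurable_continuous_onI)
qed

lemma measurable_cone_map[measurable]: "cone_map A \<in> borel_measurable borel"
  unfolding cone_map_def[abs_def] by measurable

lemma measurable_cone_map_sphere:
  assumes "A \<in> SO_plus"
  shows "cone_map A \<in> sphere_measure \<rightarrow>\<^sub>M sphere_measure"
  unfolding measurable_cong_sets[OF sets_sphere_measure sets_sphere_measure]
  by (rule measurable_restrict_space3) (auto simp: norm_cone_map[OF assms])

text \<open>
  The radial extension maps cones over subsets of the sphere to cones over their images, because it
  preserves the norm and commutes with radial projection.
\<close>
lemma cone_map_sphere_cone: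
  assumes A: "A \<in> SO_plus"
  shows "cone_map A ` sphere_cone {x. cone_map A x \<in> B} = sphere_cone B"
proof -
  let ?k = "cone_map (matrix_inv A)"
  have A': "matrix_inv A \<in> SO_plus" by (rule SO_plus_matrix_inv[OF A])
  have zero: "cone_map A x = 0 \<longleftrightarrow> x = 0" for x
    using norm_cone_map[OF A, of x] by (metis norm_eq_zero)
  have "y \<in> cone_map A ` sphere_cone {x. cone_map A x \<in> B}" if "y \<in> sphere_cone B" for y
  proof
    have y: "y \<noteq> 0" using that by (auto simp: sphere_cone_def)
    show "y = cone_map A (?k y)"
      using cone_map_inverse(2)[OF A' y] by (simp add: matrix_inv_matrix_inv_SO_plus[OF A])
    then show "?k y \<in> sphere_cone {x. cone_map A x \<in> B}"
      using that y zero[of "?k y"]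
      by (simp add: sphere_cone_def norm_cone_map[OF A'] flip: sgn_cone_map[OF A])
  qed
  moreover have "cone_map A x \<in> sphere_cone B" if "x \<in> sphere_cone {x. cone_map A x \<in> B}" for x
    using that by (simp add: sphere_cone_def norm_cone_map[OF A] zero sgn_cone_map[OF A])
  ultimately show ?thesis by blast
qed

text \<open>
  The Jacobian on the sphere is read off from the volume distortion of the radial extension on cones:
  the latter is \<open>s\<^sup>n\<close> with the degree-zero homogeneous \<open>s x = \<parallel>x\<parallel> / cone_time A x\<close>, which on the
  sphere is the conformal factor.
\<close>
lemma distr_cone_map_sphere_measure:
  fixes A :: "real ^ ('m::finite option) ^ ('m option)"
  assumes A: "A \<in> SO_plus" and n: "CARD('m) = n + 1"
  shows "distr (density sphere_measure (\<lambda>x. ennreal ((1 / cone_time A x) ^ n))) sphere_measure (cone_map A)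
    = sphere_measure"
    (is "distr (density ?\<mu> ?w) ?\<mu> _ = _")
proof (rule measure_eqI)
  note [measurable] = measurable_cone_map_sphere[OF A]
  have w[measurable]: "?w \<in> borel_measurable ?\<mu>"
    by (rule measurable_sphere_measureI) measurable
  fix B assume "B \<in> sets (distr (density ?\<mu> ?w) ?\<mu> (cone_map A))"
  then have B[measurable]: "B \<in> sets ?\<mu>" by simp
  note B' = sets_sphere_measureD[OF B]
  let ?S = "sphere_cone {x. cone_map A x \<in> B}"
  have pre: "{x. cone_map A x \<in> B} \<in> sets borel"
    using measurable_sets[OF measurable_cone_map[of A] B'(1)] by (simp add: vimage_def)
  have "emeasure (distr (density ?\<mu> ?w) ?\<mu> (cone_map A)) B =
      (\<integral>\<^sup>+x. indicator B x \<partial>distr (density ?\<mu> ?w) ?\<mu> (cone_map A))"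
    by simp
  also have "\<dots> = (\<integral>\<^sup>+x. ?w x * indicator B (cone_map A x) \<partial>?\<mu>)"
    by (simp add: nn_integral_distr nn_integral_density del: nn_integral_indicator)
  also have "\<dots> = of_nat DIM(real ^ 'm) * (\<integral>\<^sup>+x\<in>ball 0 1 - {0}. ?w (sgn x) * indicator B (cone_map A (sgn x)) \<partial>lborel)"
    by (rule nn_integral_sphere_measure) measurable
  also have "(\<integral>\<^sup>+x\<in>ball 0 1 - {0}. ?w (sgn x) * indicator B (cone_map A (sgn x)) \<partial>lborel) =
      (\<integral>\<^sup>+x\<in>?S. ennreal ((norm x / cone_time A x) ^ (CARD('m) - 1)) \<partial>lborel)"
  proof (intro nn_integral_cong)
    fix x :: "real ^ 'm"
    have "1 / cone_time A (sgn x) = norm x / cone_time A x" if "x \<noteq> 0"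
      using that by (simp add: sgn_div_norm cone_scaleR divide_inverse)
    then show "?w (sgn x) * indicator B (cone_map A (sgn x)) * indicator (ball 0 1 - {0}) x =
      ennreal ((norm x / cone_time A x) ^ (CARD('m) - 1)) * indicator ?S x"
      using n by (auto simp: sphere_cone_def indicator_def)
  qed
  also have "\<dots> = emeasure lborel (cone_map A ` ?S)"
  proof -
    obtain m where m: "0 < m" "\<And>x. m * norm x \<le> cone_time A x"
      using cone_time_bounds[OF A] by metis
    have S0: "x \<noteq> 0" if "x \<in> ?S" for x using that by (auto simp: sphere_cone_def)
    show ?thesis
    proof (rule emeasure_image_conformal_off_axis[where c = "1 / m" and u = sgn and D = "cone_map_derivative A", symmetric])
      show "?S \<in> sets borel" by (rule sphere_cone_borel[OF pre])
      show "bounded ?S"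
        by (rule bounded_subset[OF bounded_ball[of 0 1]]) (auto simp: sphere_cone_def)
      show "cone_map A ` ?S \<in> sets borel"
        unfolding cone_map_sphere_cone[OF A] by (rule sphere_cone_borel[OF B'(1)])
      show "inj_on (cone_map A) ?S"
        by (rule inj_on_inverseI[where g = "cone_map (matrix_inv A)"]) (use S0 cone_map_inverse(2)[OF A] in auto)
      fix x assume "x \<in> ?S"
      note x0 = S0[OF this]
      show "(cone_map A has_derivative cone_map_derivative A x) (at x)"
        by (rule has_derivative_cone_map[OF A x0])
      have pos: "0 < cone_time A x" by (rule cone_time_pos[OF A x0])
      show "0 < norm x / cone_time A x" using pos x0 by simp
      show "norm x / cone_time A x \<le> 1 / m"
        using m(1) m(2)[of x] pos by (simp add: field_simps)
      show "norm (sgn x) = 1" using x0 by (simp add: norm_sgn)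
      show "cone_map_derivative A x v \<bullet> cone_map_derivative A x w = (norm x / cone_time A x)\<^sup>2 * (v \<bullet> w) +
          (1 - (norm x / cone_time A x)\<^sup>2) * (sgn x \<bullet> v) * (sgn x \<bullet> w)" for v w
        by (rule cone_map_derivative_gram[OF A x0])
    qed measurable
  qed
  also have "of_nat DIM(real ^ 'm) * emeasure lborel (cone_map A ` ?S) = emeasure ?\<mu> B"
    unfolding cone_map_sphere_cone[OF A] by (rule emeasure_sphere_measure[OF B, symmetric])
  finally show "emeasure (distr (density ?\<mu> ?w) ?\<mu> (cone_map A)) B = emeasure ?\<mu> B" .
qed simp

text \<open>
  The exponent \<open>n / 2\<close> need not be an integer; for \<open>s = r\<^bsup>n/2\<^esup>\<close> the factorisation
  \<open>r\<^sup>n - 1 = (s - 1) (s + 1)\<close> reduces the claim to the integer power \<open>n\<close>.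
\<close>
lemma abs_powr_half_minus_one_le:
  fixes r R :: real
  assumes "0 < r" "r \<le> R"
  shows "\<bar>r powr (real n / 2) - 1\<bar> \<le> n * max 1 R ^ n * \<bar>r - 1\<bar>"
proof -
  define s where "s = r powr (real n / 2)"
  have s: "s > 0" using assms by (simp add: s_def)
  have "s * s = r ^ n" using assms by (simp add: s_def powr_realpow flip: powr_add)
  then have "r ^ n - 1 = (s - 1) * (s + 1)" by (simp add: algebra_simps)
  then have "\<bar>r ^ n - 1\<bar> = \<bar>s - 1\<bar> * (s + 1)" using s by (simp add: abs_mult)
  then have "\<bar>s - 1\<bar> \<le> \<bar>r ^ n - 1\<bar>"
    using mult_left_mono[of 1 "s + 1" "\<bar>s - 1\<bar>"] s by simp
  also have "\<dots> = \<bar>r - 1\<bar> * (\<Sum>i<n. r ^ i)"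
    using assms by (simp add: power_diff_1_eq abs_mult sum_nonneg)
  also have "\<dots> \<le> \<bar>r - 1\<bar> * (\<Sum>i<n. max 1 R ^ n)"
  proof (intro mult_left_mono sum_mono)
    fix i assume "i \<in> {..<n}"
    have "r ^ i \<le> max 1 R ^ i" using assms by (intro power_mono) auto
    also have "\<dots> \<le> max 1 R ^ n" using \<open>i \<in> {..<n}\<close> by (intro power_increasing) auto
    finally show "r ^ i \<le> max 1 R ^ n" .
  qed simp
  finally show ?thesis unfolding s_def by (simp add: mult.commute)
qed

text \<open>
  The conformal factor is Lipschitz and bounded away from zero, so the numerator gains one power of
  the distance over the kernel, which is just enough for convergence.
\<close>
lemma cone_time_ratio_integral_bound:
  fixes A :: "real ^ ('m::finite option) ^ ('m option)"
  assumes A: "A \<in> SO_plus" and n: "CARD('m) = n + 1"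
  obtains C where "\<And>x :: real ^ 'm. norm x = 1 \<Longrightarrow>
     (\<integral>\<^sup>+y. ennreal (\<bar>(cone_time A x / cone_time A y) powr (real n / 2) - 1\<bar> / dist x y ^ n) \<partial>sphere_measure)
       \<le> ennreal C"
proof -
  obtain m M L where m: "0 < m" and lower: "\<And>x. m * norm x \<le> cone_time A x"
    and upper: "\<And>x. cone_time A x \<le> M * norm x"
    and lip: "\<And>x y. \<bar>cone_time A x - cone_time A y\<bar> \<le> L * dist x y"
    using cone_time_bounds[OF A] by metis
  obtain c where c: "0 < c" and kernel: "\<And>x :: real ^ 'm. norm x = 1 \<Longrightarrow>
     (\<integral>\<^sup>+y. ennreal (dist x y / dist x y ^ n) \<partial>sphere_measure) \<le> ennreal c"
    using sphere_kernel_bound[where 'a = "real ^ 'm", of n] n by auto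
  let ?E = "real n * max 1 (M / m) ^ n * (\<bar>L\<bar> / m)"
  have E: "0 \<le> ?E" using m by simp
  have le: "\<bar>(cone_time A x / cone_time A y) powr (real n / 2) - 1\<bar> \<le> ?E * dist x y"
    if "norm x = 1" "norm y = 1" for x y
  proof -
    have x: "m \<le> cone_time A x" "cone_time A x \<le> M" and y: "m \<le> cone_time A y"
      using lower[of x] upper[of x] lower[of y] that by auto
    have "0 < cone_time A x / cone_time A y" "cone_time A x / cone_time A y \<le> M / m"
      using x y m by (auto intro!: frac_le divide_pos_pos)
    then have "\<bar>(cone_time A x / cone_time A y) powr (real n / 2) - 1\<bar> \<le>
        n * max 1 (M / m) ^ n * \<bar>cone_time A x / cone_time A y - 1\<bar>"
      by (rule abs_powr_half_minus_one_le)
    also have "\<bar>cone_time A x / cone_time A y - 1\<bar> = \<bar>cone_time A x - cone_time A y\<bar> / cone_time A y"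
      using y m by (simp add: diff_divide_distrib[symmetric] divide_diff_eq_iff abs_divide)
    also have "\<dots> \<le> \<bar>L\<bar> * dist x y / m"
    proof (rule frac_le)
      have "L * dist x y \<le> \<bar>L\<bar> * dist x y" by (intro mult_right_mono) auto
      then show "\<bar>cone_time A x - cone_time A y\<bar> \<le> \<bar>L\<bar> * dist x y" using lip[of x y] by simp
    qed (use y m in auto)
    finally show ?thesis by (simp add: mult_left_mono)
  qed
  show ?thesis
  proof
    fix x :: "real ^ 'm" assume x: "norm x = 1"
    have "(\<integral>\<^sup>+y. ennreal (\<bar>(cone_time A x / cone_time A y) powr (real n / 2) - 1\<bar> / dist x y ^ n) \<partial>sphere_measure)
      \<le> (\<integral>\<^sup>+y. ennreal ?E * ennreal (dist x y / dist x y ^ n) \<partial>sphere_measure)"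
    proof (rule nn_integral_mono)
      fix y :: "real ^ 'm" assume "y \<in> space sphere_measure"
      then have "norm y = 1" by (simp add: space_sphere_measure)
      from divide_right_mono[OF le[OF x this], of "dist x y ^ n"]
      have "ennreal (\<bar>(cone_time A x / cone_time A y) powr (real n / 2) - 1\<bar> / dist x y ^ n)
          \<le> ennreal (?E * (dist x y / dist x y ^ n))"
        by (intro ennreal_leI) simp
      then show "ennreal (\<bar>(cone_time A x / cone_time A y) powr (real n / 2) - 1\<bar> / dist x y ^ n)
          \<le> ennreal ?E * ennreal (dist x y / dist x y ^ n)"
        using E by (subst ennreal_mult[symmetric]) auto
    qed
    also have "\<dots> = ennreal ?E * (\<integral>\<^sup>+y. ennreal (dist x y / dist x y ^ n) \<partial>sphere_measure)"
      by (intro nn_integral_cmult measurable_sphere_measureI) measurable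
    also have "\<dots> \<le> ennreal ?E * ennreal c"
      by (intro mult_left_mono kernel x) auto
    also have "\<dots> = ennreal (?E * c)"
      using E c by (intro ennreal_mult[symmetric]) auto
    finally show "(\<integral>\<^sup>+y. ennreal (\<bar>(cone_time A x / cone_time A y) powr (real n / 2) - 1\<bar> / dist x y ^ n) \<partial>sphere_measure)
      \<le> ennreal (?E * c)" .
  qed
qed

lemma power_eq_square_powr_half:
  fixes z :: real
  assumes "0 \<le> z" "1 \<le> n"
  shows "z ^ n = (z\<^sup>2) powr (real n / 2)"
proof (cases "z = 0")
  case False
  then have z: "0 < z" using assms by simp
  then have "z\<^sup>2 = z powr 2" by simp
  then have "(z\<^sup>2) powr (real n / 2) = z powr (2 * (real n / 2))"
    by (simp only: powr_powr)
  then show ?thesis using z by (simp add: powr_realpow)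
qed (use assms in simp)

text \<open>
  The weight of the inverse map at the image point is \<open>cone_time A\<^sup>-\<^sup>1\<close> to the power \<open>n / 2\<close>, by the
  cocycle rule \<open>cone_map_inverse(1)\<close>; thus both ratio bounds are instances of the same estimate.
\<close>
lemma conformal_transport_sphere:
  fixes A :: "real ^ ('m::finite option) ^ ('m option)"
  assumes n: "n \<ge> 1" "CARD('m) = n + 1" and A: "A \<in> SO_plus"
  obtains C where "conformal_transport sphere_measure n dist (cone_map A) (cone_map (matrix_inv A))
     (\<lambda>x. (1 / cone_time A x) powr (real n / 2)) C"
proof -
  let ?B = "matrix_inv A" and ?a = "\<lambda>x. (1 / cone_time A x) powr (real n / 2)"
  have B: "?B \<in> SO_plus" by (rule SO_plus_matrix_inv[OF A])
  have pos: "0 < cone_time G x" if "G \<in> SO_plus" "norm x = 1" for G and x :: "real ^ 'm"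
    using that by (intro cone_time_pos) auto
  have inv: "cone_map ?B (cone_map A x) = x" "cone_map A (cone_map ?B x) = x"
    "cone_time A (cone_map ?B x) * cone_time ?B x = 1"
    if "norm x = 1" for x
  proof -
    have "x \<noteq> 0" using that by auto
    then show "cone_map ?B (cone_map A x) = x" "cone_map A (cone_map ?B x) = x"
      "cone_time A (cone_map ?B x) * cone_time ?B x = 1"
      using that cone_map_inverse[OF A, of x] cone_map_inverse[OF B, of x]
      by (simp_all add: matrix_inv_matrix_inv_SO_plus[OF A])
  qed
  obtain C1 where C1: "\<And>x :: real ^ 'm. norm x = 1 \<Longrightarrow>
     (\<integral>\<^sup>+y. ennreal (\<bar>(cone_time A x / cone_time A y) powr (real n / 2) - 1\<bar> / dist x y ^ n) \<partial>sphere_measure)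
       \<le> ennreal C1"
    using cone_time_ratio_integral_bound[OF A n(2)] by blast
  obtain C2 where C2: "\<And>x :: real ^ 'm. norm x = 1 \<Longrightarrow>
     (\<integral>\<^sup>+y. ennreal (\<bar>(cone_time ?B x / cone_time ?B y) powr (real n / 2) - 1\<bar> / dist x y ^ n) \<partial>sphere_measure)
       \<le> ennreal C2"
    using cone_time_ratio_integral_bound[OF B n(2)] by blast
  interpret finite_measure "sphere_measure :: (real ^ 'm) measure"
    by (rule finite_measure_sphere_measure)
  have "conformal_transport sphere_measure n dist (cone_map A) (cone_map ?B) ?a (max C1 C2)"
  proof (unfold_locales, unfold space_sphere_measure mem_sphere_0)
    show "(\<lambda>(x, y). dist x y) \<in> borel_measurable (sphere_measure \<Otimes>\<^sub>M (sphere_measure :: (real ^ 'm) measure))"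
      by (rule measurable_dist_sphere_measure)
    show "cone_map A \<in> sphere_measure \<rightarrow>\<^sub>M sphere_measure" "cone_map ?B \<in> sphere_measure \<rightarrow>\<^sub>M sphere_measure"
      by (rule measurable_cone_map_sphere[OF A], rule measurable_cone_map_sphere[OF B])
    show "?a \<in> borel_measurable sphere_measure"
      by (rule measurable_sphere_measureI) measurable
    have "(?a x)\<^sup>2 = (1 / cone_time A x) ^ n" if "norm x = 1" for x
      using pos[OF A that] by (simp add: power2_eq_square powr_realpow flip: powr_add)
    then have "density sphere_measure (\<lambda>x. ennreal ((?a x)\<^sup>2)) =
        density sphere_measure (\<lambda>x. ennreal ((1 / cone_time A x) ^ n))"
      by (intro density_cong measurable_sphere_measureI AE_I2) (auto simp: space_sphere_measure)
    then show "distr (density sphere_measure (\<lambda>x. ennreal ((?a x)\<^sup>2))) sphere_measure (cone_map A) = sphere_measure"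
      using distr_cone_map_sphere_measure[OF A n(2)] by simp
    show "0 \<le> dist x y" "dist x y = dist y x" for x y :: "real ^ 'm"
      by (auto simp: dist_commute)
    fix x :: "real ^ 'm" assume x: "norm x = 1"
    show "cone_map A (cone_map ?B x) = x" "cone_map ?B (cone_map A x) = x"
      using inv[OF x] by auto
    show "0 < ?a x" using pos[OF A x] by simp
    show "dist (cone_map A x) (cone_map A y) ^ n = ?a x * ?a y * dist x y ^ n"
      if y: "norm y = 1" for y
    proof -
      have "dist (cone_map A x) (cone_map A y) ^ n =
          ((1 / cone_time A x) * (1 / cone_time A y) * (dist x y)\<^sup>2) powr (real n / 2)"
        by (simp add: power_eq_square_powr_half[OF _ n(1)] dist_cone_map[OF A x y])
      also have "\<dots> = ?a x * ?a y * ((dist x y)\<^sup>2) powr (real n / 2)"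
        using pos[OF A x] pos[OF A y] by (simp add: powr_mult powr_divide)
      finally show ?thesis by (simp add: power_eq_square_powr_half[OF _ n(1)])
    qed
    have qB: "?a (cone_map ?B z) = cone_time ?B z powr (real n / 2)" if "norm z = 1" for z
    proof -
      have "cone_time A (cone_map ?B z) = 1 / cone_time ?B z"
        using inv(3)[OF that] pos[OF B that] by (simp add: eq_divide_eq)
      then show ?thesis by simp
    qed
    have "(\<integral>\<^sup>+y. ennreal (\<bar>?a (cone_map ?B x) / ?a (cone_map ?B y) - 1\<bar> / dist x y ^ n) \<partial>sphere_measure) =
      (\<integral>\<^sup>+y. ennreal (\<bar>(cone_time ?B x / cone_time ?B y) powr (real n / 2) - 1\<bar> / dist x y ^ n) \<partial>sphere_measure)"
    proof (intro nn_integral_cong)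
      fix y :: "real ^ 'm" assume "y \<in> space sphere_measure"
      then have y: "norm y = 1" by (simp add: space_sphere_measure)
      have "?a (cone_map ?B x) / ?a (cone_map ?B y) = (cone_time ?B x / cone_time ?B y) powr (real n / 2)"
        unfolding qB[OF x] qB[OF y] using pos[OF B x] pos[OF B y] by (simp add: powr_divide)
      then show "ennreal (\<bar>?a (cone_map ?B x) / ?a (cone_map ?B y) - 1\<bar> / dist x y ^ n) =
        ennreal (\<bar>(cone_time ?B x / cone_time ?B y) powr (real n / 2) - 1\<bar> / dist x y ^ n)" by simp
    qed
    also have "\<dots> \<le> ennreal C2" by (rule C2[OF x])
    also have "\<dots> \<le> ennreal (max C1 C2)" by (intro ennreal_leI) simp
    finally show "(\<integral>\<^sup>+y. ennreal (\<bar>?a (cone_map ?B x) / ?a (cone_map ?B y) - 1\<bar> / dist x y ^ n) \<partial>sphere_measure)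
      \<le> ennreal (max C1 C2)" .
    have "(\<integral>\<^sup>+y. ennreal (\<bar>?a y / ?a x - 1\<bar> / dist x y ^ n) \<partial>sphere_measure) =
      (\<integral>\<^sup>+y. ennreal (\<bar>(cone_time A x / cone_time A y) powr (real n / 2) - 1\<bar> / dist x y ^ n) \<partial>sphere_measure)"
    proof (intro nn_integral_cong)
      fix y :: "real ^ 'm" assume "y \<in> space sphere_measure"
      then have y: "norm y = 1" by (simp add: space_sphere_measure)
      have "?a y / ?a x = (cone_time A x / cone_time A y) powr (real n / 2)"
        using pos[OF A x] pos[OF A y] by (simp add: powr_divide)
      then show "ennreal (\<bar>?a y / ?a x - 1\<bar> / dist x y ^ n) =
        ennreal (\<bar>(cone_time A x / cone_time A y) powr (real n / 2) - 1\<bar> / dist x y ^ n)" by simp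
    qed
    also have "\<dots> \<le> ennreal C1" by (rule C1[OF x])
    also have "\<dots> \<le> ennreal (max C1 C2)" by (intro ennreal_leI) simp
    finally show "(\<integral>\<^sup>+y. ennreal (\<bar>?a y / ?a x - 1\<bar> / dist x y ^ n) \<partial>sphere_measure) \<le> ennreal (max C1 C2)" .
  qed
  then show thesis by (rule that)
qed

lemma log_form_dom_sphere_separates:
  fixes f :: "'a::euclidean_space \<Rightarrow> real"
  assumes n: "DIM('a) = Suc n"
    and f: "f \<in> L2_space sphere_measure"
    and orth: "\<forall>g\<in>log_form_dom n dist sphere_measure. L2_inner sphere_measure f g = 0"
  shows "AE x in sphere_measure. f x = 0"
proof (rule L2_zero_if_orthogonal_to_lipschitz[OF finite_measure_sphere_measure sets_sphere_measure f])
  fix F :: "'a set" and k :: nat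
  assume "closed F" "F \<noteq> {}"
  let ?g = "\<lambda>x. max 0 (1 - real k * infdist x F)"
  obtain c where kernel: "\<And>x::'a. norm x = 1 \<Longrightarrow>
     (\<integral>\<^sup>+y. ennreal (dist x y / dist x y ^ n) \<partial>sphere_measure) \<le> ennreal c"
    using sphere_kernel_bound[OF n] by blast
  have "?g \<in> log_form_dom n dist sphere_measure"
  proof (rule lipschitz_in_log_form_dom[where B = 1 and L = "real k" and D = 2 and c = c])
    have "?g \<in> borel_measurable borel"
      by (intro borel_measurable_continuous_onI continuous_intros)
    then show "?g \<in> borel_measurable sphere_measure"
      by (rule measurable_sphere_measureI)
    show "\<bar>?g x\<bar> \<le> 1" for x
      using infdist_nonneg[of x F] by (simp add: abs_if)
    show "\<bar>?g x - ?g y\<bar> \<le> real k * dist x y" for x y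
    proof -
      have "\<bar>?g x - ?g y\<bar> \<le> \<bar>real k * infdist x F - real k * infdist y F\<bar>" by linarith
      also have "\<dots> = real k * \<bar>infdist x F - infdist y F\<bar>"
        by (simp add: abs_mult flip: right_diff_distrib)
      also have "\<dots> \<le> real k * dist x y"
        by (intro mult_left_mono infdist_triangle_abs) simp
      finally show ?thesis .
    qed
    show "dist x y \<le> 2" if "x \<in> space sphere_measure" "y \<in> space sphere_measure" for x y :: 'a
      using that norm_triangle_ineq4[of x y] by (simp add: space_sphere_measure dist_norm)
    show "(\<integral>\<^sup>+y. ennreal (dist x y / dist x y ^ n) \<partial>sphere_measure) \<le> ennreal c"
      if "x \<in> space sphere_measure" for x :: 'a
      using that by (intro kernel) (simp add: space_sphere_measure)
  qed (rule finite_measure_sphere_measure measurable_dist_sphere_measure)+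
  then show "L2_inner sphere_measure f ?g = 0"
    using orth by blast
qed

theorem proposition5p14:
  fixes n :: nat and A :: "real ^ ('m::finite option) ^ ('m option)"
  assumes "n \<ge> 1" and "CARD('m) = n + 1"
    and "A \<in> SO_plus"
  defines "\<mu> \<equiv> (sphere_measure :: (real ^ 'm) measure)"
  defines "\<Delta> \<equiv> log_laplacian n dist \<mu>"
    and "Dom\<Delta> \<equiv> log_laplacian_dom n dist \<mu>"
    and "U \<equiv> lorentz_unitary n A"
  shows "(\<forall>f\<in>Dom\<Delta>. U f \<in> Dom\<Delta>) \<and>
         (\<exists>T. L2_bounded_operator \<mu> T \<and>
              (\<forall>f\<in>Dom\<Delta>. AE x in \<mu>. T f x = \<Delta> (U f) x - U (\<Delta> f) x))"
proof -
  \<comment> \<open>\<open>U\<close> composes with the action of the inverse, which therefore takes the role of \<open>h\<close>.\<close>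
  let ?B = "matrix_inv A"
  have B: "?B \<in> SO_plus" by (rule SO_plus_matrix_inv[OF assms(3)])
  obtain C where "conformal_transport \<mu> n dist (cone_map ?B) (cone_map (matrix_inv ?B))
     (\<lambda>x. (1 / cone_time ?B x) powr (real n / 2)) C"
    unfolding \<mu>_def using conformal_transport_sphere[OF assms(1,2) B] by metis
  then interpret conformal_transport \<mu> n dist "cone_map ?B" "cone_map (matrix_inv ?B)"
     "\<lambda>x. (1 / cone_time ?B x) powr (real n / 2)" C .
  have sep: "AE x in \<mu>. f x = 0"
    if "f \<in> L2_space \<mu>" "\<forall>g\<in>log_form_dom n dist \<mu>. L2_inner \<mu> f g = 0" for f
    using that assms(2) unfolding \<mu>_def by (intro log_form_dom_sphere_separates) auto
  have U: "lorentz_unitary n A f x = (1 / cone_time ?B x) powr (real n / 2) * f (cone_map ?B x)"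
    if "x \<in> space \<mu>" for f x
  proof -
    have x: "norm x = 1" using that by (simp add: \<mu>_def space_sphere_measure)
    have "2 \<le> CARD('m)" using assms(1,2) by simp
    then show ?thesis
      by (simp add: lorentz_unitary_def Let_def conformal_factor_lorentz_action[OF B x] lorentz_action_sphere[OF B x])
  qed
  have "\<forall>f\<in>log_laplacian_dom n dist \<mu>. lorentz_unitary n A f \<in> log_laplacian_dom n dist \<mu>"
    by (rule bounded_commutator(1)) (erule (1) sep, erule U)
  moreover have "\<exists>T. L2_bounded_operator \<mu> T \<and> (\<forall>f\<in>log_laplacian_dom n dist \<mu>.
      AE x in \<mu>. T f x = log_laplacian n dist \<mu> (lorentz_unitary n A f) x
        - lorentz_unitary n A (log_laplacian n dist \<mu> f) x)"
    by (rule bounded_commutator(2)) (erule (1) sep, erule U)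
  ultimately show ?thesis
    unfolding \<Delta>_def Dom\<Delta>_def assms(7) by (rule conjI)
qed

end
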